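(* For all integers $2\le k\le n$, \[\vec{c}(\{k\},n)=\prod_{i=0}^{k-2}\left\lfloor\frac{n-1+i}{k-1}\right\rfloor.\]
   Context: Directed graphs are finite with no loops and no multiple arcs (two opposite arcs $uv$ and $vu$ are allowed). A directed graph is an $L$-cycle digraph if the length of every directed cycle in it belongs to $L$. $\vec{c}(L,n)$ denotes the maximum number of directed cycles in an $n$-vertex $L$-cycle digraph. *)

theory Defs
  imports "Graph_Theory.Graph_Theory"
begin

text \<open>
  A \<^const>\<open>pair_digraph\<close> has finitely many vertices, no loops and, its arcs being ordered pairs of
  vertices, no multiple arcs; opposite arcs are allowed. A closed walk of two opposite arcs counts
  as a \<^const>\<open>pre_digraph.cycle\<close>, of length 2.
\<close>

definition cycle_digraph :: "nat set \<Rightarrow> 'a pair_pre_digraph \<Rightarrow> bool" where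
  "cycle_digraph L G \<longleftrightarrow>
     pair_digraph G \<and> (\<forall>p. pre_digraph.cycle (with_proj G) p \<longrightarrow> length p \<in> L)"

text \<open>
  \<^const>\<open>pre_digraph.cycle\<close> describes a cycle by its list of arcs from a chosen starting vertex, so a
  cycle of length \<open>l\<close> has \<open>l\<close> such lists, its rotations. Passing to the set of arcs identifies
  exactly these: each directed cycle, as a subgraph, is counted once.
\<close>

definition directed_cycles :: "'a pair_pre_digraph \<Rightarrow> ('a \<times> 'a) set set" where
  "directed_cycles G = {set p | p. pre_digraph.cycle (with_proj G) p}"

text \<open>
  Vertices are natural numbers without loss of generality: every finite digraph is isomorphic to
  one on natural numbers.
\<close>

definition max_cycles :: "nat set \<Rightarrow> nat \<Rightarrow> nat" where
  "max_cycles L n = Max {card (directed_cycles G) | G :: nat pair_pre_digraph.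
     cycle_digraph L G \<and> card (pverts G) = n}"

text \<open>The maximum is taken over a finite nonempty set.\<close>

lemma card_directed_cycles_le:
  assumes "pair_digraph G"
  shows "card (directed_cycles G) \<le> 2 ^ (card (pverts G) * card (pverts G))"
proof -
  interpret pair_digraph G by fact
  let ?V = "pverts G"
  have "directed_cycles G \<subseteq> Pow (?V \<times> ?V)"
    by (auto simp: directed_cycles_def cycle_def awalk_def dest: in_arcsD1 in_arcsD2)
  moreover have "finite (Pow (?V \<times> ?V))"
    using pair_finite_verts by simp
  ultimately have "card (directed_cycles G) \<le> card (Pow (?V \<times> ?V))"
    by (rule card_mono[rotated])
  then show ?thesis
    using pair_finite_verts by (simp add: card_Pow card_cartesian_product)
qed

lemma finite_card_directed_cycles:
  "finite {card (directed_cycles G) | G. cycle_digraph L G \<and> card (pverts G) = n}"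
  by (rule finite_subset[of _ "{..2 ^ (n * n)}"])
    (auto simp: cycle_digraph_def dest: card_directed_cycles_le)

lemma ex_card_directed_cycles:
  "{card (directed_cycles G) | G :: nat pair_pre_digraph.
     cycle_digraph L G \<and> card (pverts G) = n} \<noteq> {}"
proof -
  let ?G = "\<lparr>pverts = {..<n}, parcs = {}\<rparr> :: nat pair_pre_digraph"
  have "pair_digraph ?G"
    by unfold_locales auto
  then have "cycle_digraph L ?G"
    by (auto simp: cycle_digraph_def pre_digraph.cycle_def pre_digraph.awalk_def)
  moreover have "card (pverts ?G) = n"
    by simp
  ultimately show ?thesis
    by blast
qed

end

theory Submission
  imports Defs "HOL-Library.FuncSet"
begin

text \<open>
  Upper bound. Colour each vertex by its distance modulo \<open>k\<close> from a root of its strong component: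
  every cycle then takes exactly one vertex of each colour. Let \<open>x\<close> be a vertex farthest from \<open>r\<close>
  in the strong component of \<open>r\<close>. Two cycles through \<open>x\<close> must meet in another vertex: otherwise
  the successors \<open>w\<close>, \<open>w'\<close> of \<open>x\<close> on them are closest to \<open>r\<close> among the vertices of both cycles,
  so a path from \<open>x\<close> to \<open>r\<close> leaves the two cycles for the last time at some \<open>s\<close> and can be continued
  to whichever of \<open>w\<close>, \<open>w'\<close> lies on the cycle not containing \<open>s\<close>; this gives a cycle longer than
  \<open>k\<close>. By a shifting argument for intersecting families, at most \<open>\<Prod>i\<in>I. s i\<close> cycles pass
  through \<open>x\<close>, where \<open>s i\<close> are the class sizes and \<open>I\<close> omits the colour of \<open>x\<close> and a smallest
  other class. Deleting such vertices one at a time bounds the number of cycles by a product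
  of \<open>k - 1\<close> numbers with sum \<open>n - 1\<close>, and balanced products are the largest.

  Lower bound. Blow up all vertices but one of a \<open>k\<close>-cycle in a balanced way.
\<close>

section \<open>Products of natural numbers with a given sum\<close>

text \<open>For \<open>q > 0\<close> this says \<open>a \<le> q * ((q + 1) / q) ^ (a - q)\<close>,
  where the exponent may be negative. The exponential on the right agrees with the identity at
  \<open>a = q\<close> and \<open>a = q + 1\<close>, so by convexity it lies above it at all other
  integers. Denominators are cleared to stay within the naturals.\<close>

lemma nat_le_tangent:
  fixes a q :: nat
  shows "a * q ^ a * (q + 1) ^ q \<le> q * q ^ q * (q + 1) ^ a"
proof (cases "q \<le> a")
  case True
  then obtain b where a: "a = q + b"
    using le_Suc_ex by blast
  have "(q + b) * q ^ b \<le> q * (q + 1) ^ b"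
  proof (induction b)
    case (Suc b)
    have "(q + Suc b) * q ^ Suc b = q * ((q + b) * q ^ b) + q * q ^ b"
      by (simp add: algebra_simps)
    also have "\<dots> \<le> q * (q * (q + 1) ^ b) + q * (q + 1) ^ b"
      using Suc by (intro add_mono mult_le_mono2 power_mono) auto
    finally show ?case
      by (simp add: algebra_simps)
  qed simp
  then have "(q + b) * q ^ b * (q ^ q * (q + 1) ^ q) \<le> q * (q + 1) ^ b * (q ^ q * (q + 1) ^ q)"
    by (rule mult_le_mono1)
  then show ?thesis
    by (simp only: a power_add ac_simps)
next
  case False
  then obtain b where q: "q = a + b"
    by (metis le_Suc_ex nat_le_linear)
  \<comment> \<open>Below \<open>q\<close> the bound is reached by descending from \<open>q\<close>
    in \<open>c\<close> unit steps; \<open>c = b\<close> then gives \<open>a\<close>.\<close>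
  have "c \<le> q \<Longrightarrow> (q - c) * (q + 1) ^ c \<le> q * q ^ c" for c
  proof (induction c)
    case (Suc c)
    obtain d where d: "q = c + 1 + d"
      using Suc.prems by (metis Suc_eq_plus1 le_Suc_ex)
    have "(q - Suc c) * (q + 1) \<le> (q - c) * q"
      unfolding d by (simp add: algebra_simps)
    then have "(q - Suc c) * (q + 1) * (q + 1) ^ c \<le> (q - c) * q * (q + 1) ^ c"
      by (rule mult_le_mono1)
    also have "\<dots> \<le> q * (q * q ^ c)"
      using Suc by (simp add: ac_simps)
    finally show ?case
      by (simp only: power_Suc ac_simps)
  qed simp
  from this[of b] have "a * (q + 1) ^ b \<le> q * q ^ b"
    using q by simp
  then have "a * (q + 1) ^ b * (q ^ a * (q + 1) ^ a) \<le> q * q ^ b * (q ^ a * (q + 1) ^ a)"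
    by (rule mult_le_mono1)
  moreover have "q ^ q = q ^ a * q ^ b" "(q + 1) ^ q = (q + 1) ^ a * (q + 1) ^ b"
    by (simp_all only: q power_add)
  ultimately show ?thesis
    by (simp only: ac_simps)
qed

lemma add_div_eq:
  fixes N i m :: nat
  assumes "i < m"
  shows "(N + i) div m = (if i < m - N mod m then N div m else N div m + 1)"
proof -
  have "N + i = (N mod m + i) + (N div m) * m"
    by simp
  then have *: "(N + i) div m = N div m + (N mod m + i) div m"
    using assms by (metis div_mult_self1 less_nat_zero_code)
  have t: "N mod m < m"
    using assms by simp
  show ?thesis
  proof (cases "N mod m + i < m")
    case False
    then have "(N mod m + i) div m = 1"
      by (intro div_nat_eqI; simp; use t assms in linarith)
    then show ?thesis using * False by auto
  qed (use * in auto)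
qed

text \<open>The factors are the parts of the most even partition of \<open>N\<close> into
  \<open>m\<close> parts: adding \<open>i\<close> raises the quotient exactly for the last
  \<open>N mod m\<close> values of \<open>i\<close>.\<close>

lemma prod_add_div:
  fixes N m :: nat
  assumes "0 < m"
  shows "(\<Prod>i<m. (N + i) div m) = (N div m) ^ (m - N mod m) * (N div m + 1) ^ (N mod m)"
proof -
  have t: "N mod m < m"
    using assms by simp
  have "(\<Prod>i<m. (N + i) div m)
      = (\<Prod>i=0..<m - N mod m. (N + i) div m) * (\<Prod>i=m - N mod m..<m. (N + i) div m)"
    by (metis atLeast0LessThan diff_le_self le0 prod.atLeastLessThan_concat)
  also have "(\<Prod>i=0..<m - N mod m. (N + i) div m) = (\<Prod>i=0..<m - N mod m. N div m)"
    by (intro prod.cong) (auto simp: add_div_eq)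
  also have "(\<Prod>i=m - N mod m..<m. (N + i) div m) = (\<Prod>i=m - N mod m..<m. N div m + 1)"
    by (intro prod.cong) (auto simp: add_div_eq)
  finally show ?thesis
    using t by simp
qed

text \<open>When \<open>nat_le_tangent\<close> with \<open>q = N div m\<close> is multiplied over
  \<open>I\<close>, the exponents \<open>a i\<close> enter only through their sum \<open>N\<close>,
  and cancelling common powers leaves the balanced product. The bound on \<open>card I\<close> makes
  \<open>q\<close> positive, as the cancellation requires.\<close>

lemma prod_le_balanced:
  fixes a :: "'i \<Rightarrow> nat"
  assumes "finite I" "I \<noteq> {}" "card I \<le> sum a I"
  shows "prod a I \<le> (\<Prod>i<card I. (sum a I + i) div card I)"
proof -
  define m N where "m = card I" and "N = sum a I"
  define q t where "q = N div m" and "t = N mod m"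
  have m: "0 < m" and q: "0 < q" and N: "N = q * m + t" and t: "t < m"
    using assms by (auto simp: m_def N_def q_def t_def card_gt_0_iff div_greater_zero_iff)
  have "(\<Prod>i\<in>I. a i * q ^ a i * (q + 1) ^ q) \<le> (\<Prod>i\<in>I. q * q ^ q * (q + 1) ^ a i)"
    by (intro prod_mono) (use nat_le_tangent in auto)
  then have "prod a I * q ^ N * ((q + 1) ^ q) ^ m \<le> (q * q ^ q) ^ m * (q + 1) ^ N"
    by (simp add: prod.distrib m_def N_def power_sum)
  moreover have e: "(q * q ^ q) ^ m = q ^ m * q ^ (q * m)" "((q + 1) ^ q) ^ m = (q + 1) ^ (q * m)"
    by (simp_all only: power_mult_distrib power_mult)
  ultimately have "prod a I * q ^ t * (q ^ (q * m) * (q + 1) ^ (q * m))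
      \<le> q ^ m * (q + 1) ^ t * (q ^ (q * m) * (q + 1) ^ (q * m))"
    by (simp only: N power_add e ac_simps)
  then have "prod a I * q ^ t \<le> q ^ m * (q + 1) ^ t"
    by (rule mult_right_le_imp_le) (use q in simp)
  also have "q ^ m = q ^ (m - t) * q ^ t"
    using t by (simp flip: power_add)
  finally have "prod a I * q ^ t \<le> q ^ (m - t) * (q + 1) ^ t * q ^ t"
    by (simp only: ac_simps)
  then have "prod a I \<le> q ^ (m - t) * (q + 1) ^ t"
    by (rule mult_right_le_imp_le) (use q in simp)
  then show ?thesis
    using prod_add_div[OF m, of N] by (simp add: q_def t_def m_def N_def)
qed

text \<open>In passing from \<open>N\<close> to \<open>N + 1\<close> the count grows iff
  \<open>N mod m = c\<close>, that is, iff \<open>m\<close> divides \<open>N + (m - c)\<close>,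
  which is when the quotient jumps.\<close>

lemma card_mod_eq:
  fixes m c N :: nat
  assumes "c < m"
  shows "card {u. u < N \<and> u mod m = c} = (N + (m - 1 - c)) div m"
proof (induction N)
  case (Suc N)
  have "{u. u < Suc N \<and> u mod m = c}
      = (if N mod m = c then insert N {u. u < N \<and> u mod m = c} else {u. u < N \<and> u mod m = c})"
    by (auto simp: less_Suc_eq)
  then have "card {u. u < Suc N \<and> u mod m = c}
      = (N + (m - 1 - c)) div m + (if N mod m = c then 1 else 0)"
    using Suc by simp
  moreover have "m dvd Suc (N + (m - 1 - c)) \<longleftrightarrow> N mod m = c"
  proof -
    have "Suc (N + (m - 1 - c)) = N + (m - c)"
      using assms by simp
    moreover have "(N + (m - c)) mod m = 0 \<longleftrightarrow> N mod m = c"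
    proof -
      have "(N + (m - c)) mod m = (N mod m + (m - c)) mod m"
        by (simp add: mod_add_left_eq)
      moreover have "N mod m < m"
        using assms by simp
      moreover have "(N mod m + (m - c)) mod m = N mod m - c" if "c \<le> N mod m"
      proof -
        have "N mod m + (m - c) = (N mod m - c) + m"
          using that assms by simp
        then show ?thesis
          using \<open>N mod m < m\<close> by (simp only: mod_add_self2) simp
      qed
      ultimately show ?thesis
        using assms by (cases "c \<le> N mod m") auto
    qed
    ultimately show ?thesis
      by (simp only: dvd_eq_mod_eq_0)
  qed
  moreover have "(Suc N + (m - 1 - c)) div m
      = (if m dvd Suc (N + (m - 1 - c)) then Suc ((N + (m - 1 - c)) div m)
         else (N + (m - 1 - c)) div m)"
    by (simp add: div_Suc dvd_eq_mod_eq_0)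
  ultimately show ?case
    by simp
qed (use assms in auto)

section \<open>Intersecting families in a product of finite sets\<close>

text \<open>Number \<open>A\<close> by the residues modulo \<open>card A\<close> and let
  \<open>\<sigma> t\<close> add \<open>t\<close>. Shifts of one point by distinct amounts below
  \<open>m \<le> card A\<close> are distinct.\<close>

lemma ex_cyclic_shift:
  assumes "finite A" "m \<le> card A"
  obtains \<sigma> :: "nat \<Rightarrow> 'a \<Rightarrow> 'a" where
    "\<And>t. inj_on (\<sigma> t) A" "\<And>t x. x \<in> A \<Longrightarrow> \<sigma> t x \<in> A"
    "\<And>x s t. x \<in> A \<Longrightarrow> s < m \<Longrightarrow> t < m \<Longrightarrow> \<sigma> s x = \<sigma> t x \<Longrightarrow> s = t"
proof -
  let ?n = "card A"
  obtain e where e: "bij_betw e A {0..<?n}"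
    using ex_bij_betw_finite_nat[OF assms(1)] by blast
  define f where "f = inv_into A e"
  have fe: "f (e x) = x" if "x \<in> A" for x
    using that e by (simp add: f_def bij_betw_def)
  have ef: "e (f i) = i" "f i \<in> A" if "i < ?n" for i
    using that e by (auto simp: f_def bij_betw_def f_inv_into_f inv_into_into)
  have elt: "e x < ?n" if "x \<in> A" for x
    using that e by (auto simp: bij_betw_def)
  have mlt: "i mod ?n < ?n" if "x \<in> A" for x i
    using elt[OF that] by (intro mod_less_divisor) linarith
  have cancel: "i = j" if "(c + i) mod ?n = (c + j) mod ?n" "i < ?n" "j < ?n" for c i j :: nat
    using that
  proof (induction i j rule: linorder_wlog)
    case (le i j)
    then have "?n dvd j - i"
      by (metis add_diff_cancel_left mod_eq_dvd_iff_nat nat_add_left_cancel_le)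
    then show ?case
      using le by (metis diff_diff_cancel dvd_imp_le le_antisym less_imp_diff_less linorder_not_le
          diff_is_0_eq gr0I)
  qed metis
  show ?thesis
  proof
    fix t
    show "f ((t + e x) mod ?n) \<in> A" if "x \<in> A" for x
      using ef mlt that by blast
    show "inj_on (\<lambda>x. f ((t + e x) mod ?n)) A"
      by (rule inj_onI) (metis cancel ef(1) elt fe mlt)
  next
    fix x s t
    assume "x \<in> A" "s < m" "t < m" "f ((s + e x) mod ?n) = f ((t + e x) mod ?n)"
    then have "(e x + s) mod ?n = (e x + t) mod ?n" "s < ?n" "t < ?n"
      using ef(1) mlt assms(2) by (metis add.commute, simp_all)
    then show "s = t"
      using cancel by blast
  qed
qed

text \<open>Shifting all coordinates at once by each \<open>t < m\<close> gives \<open>m\<close>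
  copies of \<open>F\<close> inside the product. They are disjoint: two members of \<open>F\<close>
  share a value in some coordinate, and different shifts send that value to different
  places.\<close>

lemma card_intersecting_PiE_le:
  assumes "finite I" "\<And>i. i \<in> I \<Longrightarrow> finite (A i)" "\<And>i. i \<in> I \<Longrightarrow> m \<le> card (A i)"
    and F: "F \<subseteq> (\<Pi>\<^sub>E i\<in>I. A i)" "\<And>g h. g \<in> F \<Longrightarrow> h \<in> F \<Longrightarrow> \<exists>i\<in>I. g i = h i"
  shows "m * card F \<le> (\<Prod>i\<in>I. card (A i))"
proof -
  have "\<exists>\<sigma>. (\<forall>t. inj_on (\<sigma> t) (A i) \<and> \<sigma> t ` A i \<subseteq> A i) \<and>
      (\<forall>x s t. x \<in> A i \<longrightarrow> s < m \<longrightarrow> t < m \<longrightarrow> \<sigma> s x = \<sigma> t x \<longrightarrow> s = (t::nat))" if "i \<in> I" for i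
    using ex_cyclic_shift[OF assms(2)[OF that] assms(3)[OF that]] by (metis image_subsetI)
  then obtain \<sigma> where \<sigma>: "\<And>i t. i \<in> I \<Longrightarrow> inj_on (\<sigma> i t) (A i)"
    "\<And>i t x. i \<in> I \<Longrightarrow> x \<in> A i \<Longrightarrow> \<sigma> i t x \<in> A i"
    "\<And>i x s t. i \<in> I \<Longrightarrow> x \<in> A i \<Longrightarrow> s < m \<Longrightarrow> t < m \<Longrightarrow> \<sigma> i s x = \<sigma> i t x \<Longrightarrow> s = (t::nat)"
    by (metis image_subset_iff)
  define \<tau> where "\<tau> t g = (\<lambda>i\<in>I. \<sigma> i t (g i))" for t g
  have inA: "g i \<in> A i" if "g \<in> F" "i \<in> I" for g i
    using that F(1) by auto
  have fin: "finite (\<Pi>\<^sub>E i\<in>I. A i)"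
    using assms by (intro finite_PiE) auto
  then have "finite F"
    using F(1) finite_subset by blast
  have "inj_on (\<lambda>(t, g). \<tau> t g) ({..<m} \<times> F)"
  proof (rule inj_onI)
    fix x y
    assume xy: "x \<in> {..<m} \<times> F" "y \<in> {..<m} \<times> F"
      "(\<lambda>(t, g). \<tau> t g) x = (\<lambda>(t, g). \<tau> t g) y"
    obtain s g t h where st: "x = (s, g)" "y = (t, h)"
      by (meson surj_pair)
    have *: "s \<in> {..<m}" "g \<in> F" "t \<in> {..<m}" "h \<in> F" and eq: "\<tau> s g = \<tau> t h"
      using xy by (auto simp: st)
    have eq': "\<sigma> i s (g i) = \<sigma> i t (h i)" if "i \<in> I" for i
      using fun_cong[OF eq, of i] that by (simp add: \<tau>_def)
    obtain i where "i \<in> I" "g i = h i"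
      using F(2) * by blast
    then have "s = t"
      using eq'[of i] \<sigma>(3)[of i "g i" s t] inA * by auto
    have "g i = h i" if "i \<in> I" for i
      using eq'[OF that] \<sigma>(1)[OF that, of t] inA that * \<open>s = t\<close> by (auto dest: inj_onD)
    then have "g = h"
      using * F(1) by (intro PiE_ext[of g I A h]) auto
    then show "x = y"
      using \<open>s = t\<close> st by simp
  qed
  moreover have "(\<lambda>(t, g). \<tau> t g) ` ({..<m} \<times> F) \<subseteq> (\<Pi>\<^sub>E i\<in>I. A i)"
    using inA \<sigma>(2) by (auto simp: \<tau>_def)
  ultimately have "card ({..<m} \<times> F) \<le> card (\<Pi>\<^sub>E i\<in>I. A i)"
    using fin by (rule card_inj_on_le)
  then show ?thesis
    using assms(1) by (simp add: card_PiE card_cartesian_product)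
qed

section \<open>Cycles as lists of vertices\<close>

text \<open>The closing arc is kept apart from the path condition, so that cycles can be cut and
  spliced as paths.\<close>

definition vcycle :: "('a \<times> 'a) set \<Rightarrow> 'a list \<Rightarrow> bool" where
  "vcycle E vs \<longleftrightarrow> vs \<noteq> [] \<and> distinct vs \<and> successively (\<lambda>u v. (u, v) \<in> E) vs \<and> (last vs, hd vs) \<in> E"

lemma vcycle_conv_nth:
  "vcycle E vs \<longleftrightarrow> vs \<noteq> [] \<and> distinct vs \<and>
     (\<forall>i<length vs. (vs ! i, vs ! (Suc i mod length vs)) \<in> E)"
proof (cases vs rule: rev_cases)
  case (snoc us u)
  have "(\<forall>i<length vs. (vs ! i, vs ! (Suc i mod length vs)) \<in> E) \<longleftrightarrow>
      (\<forall>i<length us. (vs ! i, vs ! Suc i) \<in> E) \<and> (last vs, hd vs) \<in> E"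
    by (simp add: snoc All_less_Suc hd_conv_nth nth_append)
       (metis (no_types, lifting) One_nat_def Suc_lessI append.simps(1) diff_Suc_1 hd_conv_nth
         less_Suc_eq list.sel(1) list.size(3) mod_less mod_self not_less_eq nth_Cons_0)
  then show ?thesis
    by (auto simp: vcycle_def successively_conv_nth snoc)
qed (simp add: vcycle_def)

lemma vcycle_mono: "vcycle E vs \<Longrightarrow> E \<subseteq> E' \<Longrightarrow> vcycle E' vs"
  unfolding vcycle_conv_nth by blast

lemma vcycle_rotate1: "vcycle E (v # vs) \<Longrightarrow> vcycle E (vs @ [v])"
  by (cases vs) (auto simp: vcycle_def successively_append_iff successively_Cons split: if_splits)

lemma vcycle_rotate:
  assumes "vcycle E (xs @ ys)"
  shows "vcycle E (ys @ xs)"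
  using assms
proof (induction xs arbitrary: ys)
  case (Cons x xs)
  then show ?case
    using vcycle_rotate1[of E x "xs @ ys"] Cons.IH[of "ys @ [x]"] by simp
qed simp

lemma vcycle_rotate_to:
  assumes "vcycle E vs" "v \<in> set vs"
  obtains ws where "vcycle E (v # ws)" "set (v # ws) = set vs"
proof -
  obtain xs ys where "vs = xs @ v # ys"
    using assms(2) by (meson split_list)
  then show ?thesis
    using that[of "ys @ xs"] vcycle_rotate[of E xs "v # ys"] assms(1) by auto
qed

section \<open>Walks, paths and reachability\<close>

lemma successively_imp_relpow:
  assumes "successively (\<lambda>u v. (u, v) \<in> E) (xs @ u # ys @ v # zs)"
  shows "(u, v) \<in> E ^^ (Suc (length ys))"
  using assms
proof (induction ys arbitrary: v zs rule: rev_induct)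
  case (snoc y ys)
  have "(u, y) \<in> E ^^ Suc (length ys)"
    by (rule snoc.IH[of y "v # zs"]) (use snoc.prems in simp)
  moreover have "(y, v) \<in> E"
    using snoc.prems successively_append_iff[of _ "xs @ u # ys" "y # v # zs"] by simp
  ultimately show ?case
    by auto
qed (auto simp: successively_append_iff successively_Cons)

lemma vcycle_connected:
  assumes "vcycle E vs" "u \<in> set vs" "v \<in> set vs"
  shows "(u, v) \<in> E\<^sup>*"
proof (cases "u = v")
  case False
  obtain ws where ws: "vcycle E (u # ws)" "set (u # ws) = set vs"
    using vcycle_rotate_to[OF assms(1,2)] by blast
  then have "v \<in> set ws"
    using assms(3) False by auto
  then obtain ys zs where "ws = ys @ v # zs"
    by (meson split_list)
  then have "successively (\<lambda>u v. (u, v) \<in> E) ([] @ u # ys @ v # zs)"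
    using ws(1) by (simp add: vcycle_def)
  then show ?thesis
    by (rule successively_imp_relpow[THEN relpow_imp_rtrancl])
qed simp

lemma rtrancl_distinct_path:
  assumes "(u, v) \<in> E\<^sup>*" "u \<noteq> v"
  obtains us where "distinct (us @ [v])" "us \<noteq> []" "hd us = u"
    "successively (\<lambda>u v. (u, v) \<in> E) (us @ [v])"
proof -
  have "u \<noteq> v \<longrightarrow> (\<exists>us. distinct (us @ [v]) \<and> us \<noteq> [] \<and> hd us = u \<and>
      successively (\<lambda>u v. (u, v) \<in> E) (us @ [v]))"
    using assms(1)
  proof (induction rule: converse_rtrancl_induct)
    case (step a b)
    show ?case
    proof
      assume "a \<noteq> v"
      show "\<exists>us. distinct (us @ [v]) \<and> us \<noteq> [] \<and> hd us = a \<and>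
          successively (\<lambda>u v. (u, v) \<in> E) (us @ [v])"
      proof (cases "b = v")
        case True
        then show ?thesis
          using step \<open>a \<noteq> v\<close> by (intro exI[of _ "[a]"]) auto
      next
        case False
        then obtain us where us: "distinct (us @ [v])" "us \<noteq> []" "hd us = b"
          "successively (\<lambda>u v. (u, v) \<in> E) (us @ [v])"
          using step by blast
        show ?thesis
        proof (cases "a \<in> set us")
          case True
          then obtain xs ys where "us = xs @ a # ys"
            by (meson split_list)
          then show ?thesis
            using us by (intro exI[of _ "a # ys"]) (auto simp: successively_append_iff)
        next
          case False
          then show ?thesis
            using us step \<open>a \<noteq> v\<close> by (intro exI[of _ "a # us"]) (auto simp: successively_Cons)
        qed
      qed
    qed
  qed simp
  then show ?thesis
    using that assms(2) by blast
qed

text \<open>A walk from \<open>a\<close> to \<open>r\<close> is cut after its last vertex in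
  \<open>H\<close>, if there is one. Only tails are kept outside \<open>H\<close>, so that the
  remaining path can later be continued to an end in \<open>H\<close>.\<close>

lemma rtrancl_last_visit:
  assumes "(a, r) \<in> E\<^sup>*" "r \<notin> H"
  shows "(a, r) \<in> {(u, v) \<in> E. u \<notin> H}\<^sup>* \<or>
    (\<exists>s t. s \<in> H \<and> t \<notin> H \<and> (s, t) \<in> E \<and> (t, r) \<in> {(u, v) \<in> E. u \<notin> H}\<^sup>*)"
  using assms(1)
proof (induction rule: converse_rtrancl_induct)
  case (step a b)
  show ?case
  proof (cases "(b, r) \<in> {(u, v) \<in> E. u \<notin> H}\<^sup>*")
    case True
    then have "b \<notin> H"
      using assms(2) by (auto elim: converse_rtranclE)
    show ?thesis
    proof (cases "a \<in> H")
      case False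
      then have "(a, b) \<in> {(u, v) \<in> E. u \<notin> H}"
        using step by auto
      then show ?thesis
        using True by (meson converse_rtrancl_into_rtrancl)
    qed (use step True \<open>b \<notin> H\<close> in blast)
  qed (use step in blast)
qed simp

text \<open>A nonempty closed walk without repeated vertices is a cycle and has length
  \<open>k\<close>; at a repetition it splits into two shorter closed walks.\<close>

lemma relpow_closed_dvd:
  assumes len: "\<And>vs. vcycle E vs \<Longrightarrow> length vs = k"
    and "(r, r) \<in> E ^^ m"
  shows "k dvd m"
  using assms(2)
proof (induction m arbitrary: r rule: less_induct)
  case (less m)
  obtain f where f: "f 0 = r" "f m = r" "\<And>i. i < m \<Longrightarrow> (f i, f (Suc i)) \<in> E"
    using less.prems by (auto simp: relpow_fun_conv)
  have walk: "(f i, f (i + l)) \<in> E ^^ l" if "i + l \<le> m" for i l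
    using that f(3) by (auto simp: relpow_fun_conv intro!: exI[of _ "\<lambda>j. f (i + j)"])
  show ?case
  proof (cases "m = 0 \<or> inj_on f {..<m}")
    case True
    show ?thesis
    proof (cases "m = 0")
      case False
      have "f (Suc i mod m) = f (Suc i)" if "i < m" for i
        using that f(1,2) by (cases "Suc i = m") auto
      then have "vcycle E (map f [0..<m])"
        using True False f(3) by (auto simp: vcycle_conv_nth distinct_map atLeast0LessThan)
      then show ?thesis
        using len by fastforce
    qed simp
  next
    case False
    then obtain i j where ij: "i < j" "j < m" "f i = f j"
      unfolding inj_on_def by (metis lessThan_iff linorder_neqE_nat)
    have 1: "(f i, f i) \<in> E ^^ (j - i)"
      using walk[of i "j - i"] ij by simp
    have "(r, f i) \<in> E ^^ i" "(f j, r) \<in> E ^^ (m - j)"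
      using walk[of 0 i] walk[of j "m - j"] ij f by auto
    then have 2: "(r, r) \<in> E ^^ (i + (m - j))"
      using ij(3) by (metis relcompI relpow_add)
    have "k dvd j - i" "k dvd i + (m - j)"
      using less.IH[OF _ 1] less.IH[OF _ 2] ij by auto
    then have "k dvd (j - i) + (i + (m - j))"
      by (rule dvd_add)
    then show ?thesis
      using ij by simp
  qed
qed

section \<open>Colouring modulo the cycle length\<close>

text \<open>The colour of \<open>u\<close> is the length modulo \<open>k\<close> of any walk to
  \<open>u\<close> from the representative of its strong component.\<close>

lemma ex_colouring:
  assumes len: "\<And>vs. vcycle E vs \<Longrightarrow> length vs = k" and "0 < k"
  obtains col :: "'a \<Rightarrow> nat" where "\<And>u. col u < k"
    "\<And>u v. (u, v) \<in> E \<Longrightarrow> (v, u) \<in> E\<^sup>* \<Longrightarrow> col v = Suc (col u) mod k"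
proof -
  define C where "C u = {v. (u, v) \<in> E\<^sup>* \<and> (v, u) \<in> E\<^sup>*}" for u
  define rep where "rep u = (SOME v. v \<in> C u)" for u
  define dst where "dst u = (SOME m. (rep u, u) \<in> E ^^ m)" for u
  have "u \<in> C u" for u
    by (simp add: C_def)
  then have "rep u \<in> C u" for u
    unfolding rep_def by (metis someI)
  then have rep: "(rep u, u) \<in> E\<^sup>*" "(u, rep u) \<in> E\<^sup>*" for u
    by (auto simp: C_def)
  have dst: "(rep u, u) \<in> E ^^ dst u" for u
    unfolding dst_def using rep(1)[of u] by (metis rtrancl_imp_relpow someI_ex)
  have closed: "k dvd m" if "(r, r) \<in> E ^^ m" for r m
    using len that by (rule relpow_closed_dvd)
  \<comment> \<open>Closing both walks by the same return walk gives two closed walks. Their lengths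
    are divisible by \<open>k\<close>, so \<open>a\<close> and \<open>b\<close> are
    congruent.\<close>
  have uniq: "a mod k = b mod k" if *: "(r, u) \<in> E ^^ a" "(r, u) \<in> E ^^ b" "(u, r) \<in> E\<^sup>*" for r u a b
  proof -
    obtain c where c: "(u, r) \<in> E ^^ c"
      using *(3) rtrancl_imp_relpow by blast
    have "(r, r) \<in> E ^^ (a + c)" "(r, r) \<in> E ^^ (b + c)"
      using * c by (metis relcompI relpow_add)+
    then have "k dvd a + c" "k dvd b + c"
      using closed by blast+
    then have "k dvd a - b" "k dvd b - a"
      using dvd_diff_nat[of k "a + c" "b + c"] dvd_diff_nat[of k "b + c" "a + c"]
      unfolding add_diff_cancel_right by blast+
    then show ?thesis
      using mod_eq_dvd_iff_nat[of a b k] mod_eq_dvd_iff_nat[of b a k]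
      by (cases "a \<le> b") auto
  qed
  show ?thesis
  proof
    show "dst u mod k < k" for u
      using \<open>0 < k\<close> by simp
    fix u v
    assume uv: "(u, v) \<in> E" "(v, u) \<in> E\<^sup>*"
    \<comment> \<open>An arc with a way back stays in one strong component. As \<open>rep\<close>
      depends on the set \<open>C u\<close> alone, both ends get the same representative.\<close>
    then have "C u = C v"
      unfolding C_def by (auto intro: rtrancl_trans converse_rtrancl_into_rtrancl)
    then have r: "rep u = rep v"
      by (simp add: rep_def)
    have "(rep v, v) \<in> E ^^ Suc (dst u)"
      using dst[of u] uv(1) r by auto
    then have "dst v mod k = Suc (dst u) mod k"
      using uniq[OF dst _ rep(2)] by blast
    then show "dst v mod k = Suc (dst u mod k) mod k"
      by (simp add: mod_Suc_eq)
  qed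
qed

section \<open>A vertex whose cycles pairwise meet elsewhere\<close>

lemma successively_butlast:
  assumes "successively P (us @ [w])" "\<And>u v. P u v \<Longrightarrow> Q u" "u \<in> set us"
  shows "Q u"
  using assms(1,3)
proof (induction us)
  case (Cons a us)
  then show ?case
    using assms(2) by (cases us) auto
qed simp

text \<open>The new cycle follows all of \<open>q\<close> to \<open>x\<close>, then \<open>p\<close>
  up to \<open>s\<close>, steps to \<open>t\<close> and returns to \<open>hd q\<close> outside
  \<open>H\<close>. It contains \<open>q\<close>, \<open>x\<close> and also \<open>t\<close>, so it
  is longer than \<open>x # q\<close>. The case \<open>s = x\<close> is included.\<close>

lemma vcycle_detour:
  assumes p: "vcycle E (x # p)" and q: "vcycle E (x # q)" "q \<noteq> []"
    and disj: "set p \<inter> set q = {}"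
    and H: "H = insert x (set p \<union> set q)"
    and st: "s \<in> set (x # p)" "t \<notin> H" "(s, t) \<in> E"
    and tq: "(t, hd q) \<in> {(u, v) \<in> E. u \<notin> H}\<^sup>*"
  obtains vs where "vcycle E vs" "length (x # q) < length vs"
proof -
  have "t \<noteq> hd q"
    using q(2) H st(2) by auto
  then obtain us where us: "distinct (us @ [hd q])" "us \<noteq> []" "hd us = t"
    "successively (\<lambda>u v. (u, v) \<in> {(u, v) \<in> E. u \<notin> H}) (us @ [hd q])"
    using rtrancl_distinct_path[OF tq] by blast
  have us_H: "u \<notin> H" if "u \<in> set us" for u
    using successively_butlast[OF us(4) _ that, of "\<lambda>u. u \<notin> H"] by blast
  have us_E: "successively (\<lambda>u v. (u, v) \<in> E) (us @ [hd q])"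
    by (rule successively_mono[OF us(4)]) simp
  obtain p1 p2 where p12: "x # p = p1 @ s # p2"
    using st(1) by (meson split_list)
  then have hd_p1: "hd (p1 @ [s]) = x"
    by (cases p1) auto
  have "successively (\<lambda>u v. (u, v) \<in> E) ((p1 @ [s]) @ p2)"
    using p p12 by (simp add: vcycle_def)
  then have p1_E: "successively (\<lambda>u v. (u, v) \<in> E) (p1 @ [s])"
    using successively_append_iff by blast
  have p1_set: "set (p1 @ [s]) \<subseteq> insert x (set p)"
    using arg_cong[OF p12, of set] by auto
  have p1_dist: "distinct (p1 @ [s])"
    using p p12 by (auto simp: vcycle_def)
  have q_E: "successively (\<lambda>u v. (u, v) \<in> E) q" "(last q, x) \<in> E" "distinct q" "x \<notin> set q"
    using q by (auto simp: vcycle_def successively_Cons)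
  have us_E': "successively (\<lambda>u v. (u, v) \<in> E) us" "(last us, hd q) \<in> E"
    using us_E us(2) by (auto simp: successively_append_iff)
  define vs where "vs = q @ (p1 @ [s]) @ us"
  have "successively (\<lambda>u v. (u, v) \<in> E) ((p1 @ [s]) @ us)"
    unfolding successively_append_iff[of _ "p1 @ [s]" us]
    using p1_E us_E'(1) us(3) st(3) by simp
  then have "successively (\<lambda>u v. (u, v) \<in> E) vs"
    unfolding vs_def successively_append_iff[of _ q]
    using q_E(1,2) hd_p1 by (auto simp: hd_append)
  moreover have "distinct vs"
    using q_E(3,4) p1_dist p1_set us(1) us_H disj unfolding vs_def H
    by (simp add: disjoint_iff) blast
  moreover have "(last vs, hd vs) \<in> E"
    using us(2) q(2) us_E'(2) by (simp add: vs_def)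
  ultimately have "vcycle E vs"
    by (simp add: vcycle_def vs_def)
  moreover have "length (x # q) < length vs"
    using us(2) by (cases us) (auto simp: vs_def)
  ultimately show ?thesis
    using that by blast
qed

text \<open>The colouring is part of the data in place of strong connectedness: deleting a vertex
  may destroy the latter but leaves the colouring valid.\<close>

locale coloured_digraph =
  fixes V :: "'a set" and E :: "('a \<times> 'a) set" and col :: "'a \<Rightarrow> nat" and k :: nat
  assumes finite_V: "finite V"
    and arcs: "E \<subseteq> V \<times> V"
    and k_ge: "2 \<le> k"
    and col_less: "\<And>v. v \<in> V \<Longrightarrow> col v < k"
    and col_arc: "\<And>u v. (u, v) \<in> E \<Longrightarrow> col v = Suc (col u) mod k"
    and length_vcycle: "\<And>vs. vcycle E vs \<Longrightarrow> length vs = k"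
begin

lemma col_relpow:
  assumes "(u, v) \<in> E ^^ m" "u \<in> V"
  shows "col v = (col u + m) mod k"
  using assms(1)
proof (induction m arbitrary: v)
  case (Suc m)
  then obtain w where w: "(u, w) \<in> E ^^ m" "(w, v) \<in> E"
    by auto
  then show ?case
    using Suc.IH[OF w(1)] col_arc[OF w(2)] by (simp add: mod_Suc_eq)
qed (use assms(2) col_less in simp)

text \<open>The witness maximises the distance \<open>d\<close> from \<open>r\<close> within the
  strong component \<open>K\<close> of \<open>r\<close>. Two cycles meeting only there could be
  rerouted by \<open>vcycle_detour\<close> into a cycle longer than \<open>k\<close>.\<close>

lemma ex_intersecting_vertex:
  assumes "V \<noteq> {}"
  shows "\<exists>x\<in>V. \<forall>p q. vcycle E (x # p) \<longrightarrow> vcycle E (x # q) \<longrightarrow> set p \<inter> set q \<noteq> {}"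
proof -
  obtain r where r: "r \<in> V"
    using assms by blast
  define d where "d v = (LEAST m. (r, v) \<in> E ^^ m)" for v
  define K where "K = {v. (r, v) \<in> E\<^sup>* \<and> (v, r) \<in> E\<^sup>*}"
  have d_le: "d v \<le> m" if "(r, v) \<in> E ^^ m" for v m
    unfolding d_def using that by (rule Least_le)
  have d: "(r, v) \<in> E ^^ d v" if "(r, v) \<in> E\<^sup>*" for v
    unfolding d_def using rtrancl_imp_relpow[OF that] by (rule LeastI_ex)
  have "K \<subseteq> V"
    using r arcs by (auto simp: K_def elim: rtranclE)
  then have "finite K"
    using finite_V finite_subset by blast
  have "r \<in> K"
    by (simp add: K_def)
  then have "Max (d ` K) \<in> d ` K"
    using \<open>finite K\<close> by (intro Max_in) auto
  then obtain x where "x \<in> K" "d x = Max (d ` K)"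
    by auto
  then have x: "x \<in> K" "\<And>y. y \<in> K \<Longrightarrow> d y \<le> d x"
    using \<open>finite K\<close> by auto
  have rx: "(r, x) \<in> E\<^sup>*" "(x, r) \<in> E\<^sup>*"
    using x(1) by (auto simp: K_def)
  \<comment> \<open>From any other vertex \<open>u\<close> of the cycle, at most
    \<open>k - 1\<close> arcs lead on to \<open>x\<close>, so \<open>d u\<close> is at least
    \<open>d x + 1 - k\<close>. The successor of \<open>x\<close> attains this bound and hence is
    closest to \<open>r\<close>.\<close>
  have cyc: "p \<noteq> [] \<and> (r, hd p) \<in> E\<^sup>* \<and> d (hd p) + k = Suc (d x) \<and> (\<forall>u\<in>set (x # p). d (hd p) \<le> d u)"
    if p: "vcycle E (x # p)" for p
  proof -
    have len: "Suc (length p) = k"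
      using length_vcycle[OF p] by simp
    then have "p \<noteq> []"
      using k_ge by auto
    have *: "u \<in> K \<and> Suc (d x) \<le> d u + k" if u: "u \<in> set p" for u
    proof -
      obtain ys zs where p_eq: "p = ys @ u # zs"
        using u by (meson split_list)
      have xu: "(x, u) \<in> E\<^sup>*"
        using vcycle_connected[OF p] u by simp
      have "vcycle E ((u # zs) @ (x # ys))"
        by (rule vcycle_rotate) (use p p_eq in simp)
      then have "successively (\<lambda>u v. (u, v) \<in> E) ([] @ u # zs @ x # ys)"
        by (simp add: vcycle_def)
      then have ux: "(u, x) \<in> E ^^ Suc (length zs)"
        by (rule successively_imp_relpow)
      have ru: "(r, u) \<in> E\<^sup>*"
        using rx(1) xu by (rule rtrancl_trans)
      have "(r, x) \<in> E ^^ (d u + Suc (length zs))"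
        using d[OF ru] ux by (metis relcompI relpow_add)
      then have "d x \<le> d u + Suc (length zs)"
        by (rule d_le)
      moreover have "Suc (length zs) < k"
        using len p_eq by simp
      moreover have "u \<in> K"
        using ru ux rx(2) by (auto simp: K_def dest: relpow_imp_rtrancl intro: rtrancl_trans)
      ultimately show ?thesis
        by auto
    qed
    have w: "hd p \<in> K" "Suc (d x) \<le> d (hd p) + k"
      using *[of "hd p"] \<open>p \<noteq> []\<close> by auto
    then have w': "d (hd p) \<le> d x" "(r, hd p) \<in> E\<^sup>*"
      using x(2) by (auto simp: K_def)
    \<comment> \<open>Colours record distances modulo \<open>k\<close>, so \<open>d (hd p)\<close>
      is congruent to \<open>d x + 1\<close>. By maximality of \<open>d x\<close> it is smaller,
      hence smaller by at least \<open>k\<close>.\<close>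
    have "(x, hd p) \<in> E"
      using p \<open>p \<noteq> []\<close> by (auto simp: vcycle_def successively_Cons)
    then have "col (hd p) = Suc (col x) mod k"
      by (rule col_arc)
    then have "(col r + Suc (d x)) mod k = (col r + d (hd p)) mod k"
      using col_relpow[OF d[OF w'(2)] r] col_relpow[OF d[OF rx(1)] r] by (simp add: mod_Suc_eq)
    then have "k dvd (col r + Suc (d x)) - (col r + d (hd p))"
      using w'(1) by (subst (asm) mod_eq_dvd_iff_nat) auto
    then have "k dvd Suc (d x) - d (hd p)"
      by simp
    then have "k \<le> Suc (d x) - d (hd p)"
      using w'(1) by (intro dvd_imp_le) auto
    then have "d (hd p) + k = Suc (d x)"
      using w(2) w'(1) by simp
    then show ?thesis
      using * w' \<open>p \<noteq> []\<close> by fastforce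
  qed
  have "set p \<inter> set q \<noteq> {}" if p: "vcycle E (x # p)" and q: "vcycle E (x # q)" for p q
  proof
    assume disj: "set p \<inter> set q = {}"
    note P = cyc[OF p] and Q = cyc[OF q]
    define H where "H = insert x (set p \<union> set q)"
    have dH: "d (hd p) \<le> d u" "d (hd q) \<le> d u" if "u \<in> H" for u
      using that P Q by (auto simp: H_def)
    \<comment> \<open>If \<open>r\<close> were in \<open>H\<close>, both successors of
      \<open>x\<close> would have distance 0 and equal \<open>r\<close>, although \<open>p\<close>
      and \<open>q\<close> are disjoint.\<close>
    have "r \<notin> H"
    proof
      assume "r \<in> H"
      moreover have "d r = 0"
        using d_le[of r 0] by simp
      ultimately have "d (hd p) = 0" "d (hd q) = 0"
        using dH[of r] by auto
      then have "hd p = r" "hd q = r"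
        using d[of "hd p"] d[of "hd q"] P Q by auto
      then show False
        using disj P Q by (metis IntI empty_iff hd_in_set)
    qed
    \<comment> \<open>Before its end, a shortest path to \<open>w\<close> visits only vertices
      closer to \<open>r\<close> than \<open>w\<close>, and none of these lies in
      \<open>H\<close>.\<close>
    have reach: "(r, w) \<in> {(u, v) \<in> E. u \<notin> H}\<^sup>*"
      if w: "(r, w) \<in> E\<^sup>*" "\<And>u. u \<in> H \<Longrightarrow> d w \<le> d u" for w
    proof -
      obtain f where f: "f 0 = r" "f (d w) = w" "\<And>i. i < d w \<Longrightarrow> (f i, f (Suc i)) \<in> E"
        using d[OF w(1)] by (auto simp: relpow_fun_conv)
      have *: "(r, f i) \<in> E ^^ i \<and> (r, f i) \<in> {(u, v) \<in> E. u \<notin> H}\<^sup>*" if "i \<le> d w" for i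
        using that
      proof (induction i)
        case (Suc i)
        then have "d (f i) \<le> i"
          using d_le by simp
        then have "f i \<notin> H"
          using w(2)[of "f i"] Suc.prems by auto
        then have "(f i, f (Suc i)) \<in> {(u, v) \<in> E. u \<notin> H}"
          using f(3) Suc.prems by simp
        then show ?case
          using Suc f(3)[of i] rtrancl_into_rtrancl[of r "f i"] by auto
      qed (simp add: f(1))
      show ?thesis
        using *[of "d w"] f(2) by simp
    qed
    have reach': "(r, hd p) \<in> {(u, v) \<in> E. u \<notin> H}\<^sup>*" "(r, hd q) \<in> {(u, v) \<in> E. u \<notin> H}\<^sup>*"
      using P Q dH by (auto intro!: reach)
    have "x \<in> H"
      by (simp add: H_def)
    then have "(x, r) \<notin> {(u, v) \<in> E. u \<notin> H}\<^sup>*"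
      using \<open>r \<notin> H\<close> by (auto elim: converse_rtranclE)
    then obtain s t where st: "s \<in> H" "t \<notin> H" "(s, t) \<in> E" "(t, r) \<in> {(u, v) \<in> E. u \<notin> H}\<^sup>*"
      using rtrancl_last_visit[OF rx(2) \<open>r \<notin> H\<close>] by blast
    then have t: "(t, hd p) \<in> {(u, v) \<in> E. u \<notin> H}\<^sup>*" "(t, hd q) \<in> {(u, v) \<in> E. u \<notin> H}\<^sup>*"
      using reach' by (auto intro: rtrancl_trans)
    \<comment> \<open>The detour ends on the cycle that does not contain \<open>s\<close>; when
      \<open>s\<close> is not on \<open>x # p\<close>, the roles of \<open>p\<close> and
      \<open>q\<close> are swapped.\<close>
    have "\<exists>vs. vcycle E vs \<and> k < length vs"
    proof (cases "s \<in> set (x # p)")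
      case True
      then show ?thesis
        using vcycle_detour[OF p q _ disj H_def True st(2,3) t(2)] Q length_vcycle[OF q] by metis
    next
      case False
      then have "s \<in> set (x # q)" "set q \<inter> set p = {}" "H = insert x (set q \<union> set p)"
        using st(1) disj by (auto simp: H_def)
      then show ?thesis
        using vcycle_detour[OF q p _ _ _ _ st(2,3) t(1)] P length_vcycle[OF p] by metis
    qed
    then show False
      using length_vcycle by fastforce
  qed
  then show ?thesis
    using x(1) \<open>K \<subseteq> V\<close> by blast
qed

end

section \<open>Counting cycles by deleting vertices\<close>

lemma prod_Diff_insert:
  fixes s :: "'a \<Rightarrow> 'b::comm_monoid_mult"
  assumes "finite I" "a \<in> I" "a \<notin> J"
  shows "prod s (I - J) = s a * prod s (I - insert a J)"
proof -
  have "I - J - {a} = I - insert a J"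
    by blast
  then show ?thesis
    using prod.remove[of "I - J" a s] assms by simp
qed

text \<open>After the common factors are removed, the right side minus the left is
  \<open>(s p - 1) * (s q - s w)\<close>.\<close>

lemma merged_prod_exchange:
  fixes s :: "'i \<Rightarrow> nat"
  assumes "finite I" "p \<in> I" "q \<in> I" "w \<in> I" "p \<noteq> q" "p \<noteq> w" "1 \<le> s p" "s w \<le> s q"
  shows "(s p + s q - 1) * prod s (I - {p, q}) \<le> (s p + s w - 1) * prod s (I - {p, w})"
proof (cases "q = w")
  case False
  have 1: "prod s (I - {p, q}) = s w * prod s (I - {w, p, q})"
    by (rule prod_Diff_insert) (use assms False in auto)
  have "prod s (I - {p, w}) = s q * prod s (I - {q, p, w})"
    by (rule prod_Diff_insert) (use assms False in auto)
  moreover have "{q, p, w} = {w, p, q}"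
    by blast
  ultimately have 2: "prod s (I - {p, w}) = s q * prod s (I - {w, p, q})"
    by simp
  obtain c where c: "s p = Suc c"
    using assms(7) by (cases "s p") auto
  have "(s p + s q - 1) * s w = c * s w + s q * s w"
    by (simp add: c algebra_simps)
  also have "\<dots> \<le> c * s q + s q * s w"
    using assms(8) by simp
  also have "\<dots> = (s p + s w - 1) * s q"
    by (simp add: c algebra_simps)
  finally have "(s p + s q - 1) * s w * prod s (I - {w, p, q})
      \<le> (s p + s w - 1) * s q * prod s (I - {w, p, q})"
    by (rule mult_le_mono1)
  then show ?thesis
    by (simp only: 1 2 ac_simps)
qed simp

text \<open>This is the arithmetic of deleting one vertex of class \<open>j\<close>:
  \<open>c\<close> counts the cycles that remain, and \<open>prod s (I - {j, w})\<close> bounds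
  those destroyed. The merged pair is first moved so as to contain the smallest other class
  \<open>w\<close>; restoring the vertex then gains at least the second term.\<close>

lemma merged_prod_step:
  fixes s :: "'i \<Rightarrow> nat"
  assumes I: "finite I" "j \<in> I" "w \<in> I" "w \<noteq> j"
    and s: "\<And>i. i \<in> I \<Longrightarrow> 1 \<le> s i" "\<And>i. i \<in> I \<Longrightarrow> i \<noteq> j \<Longrightarrow> s w \<le> s i" "2 \<le> s j"
    and s': "s' = s(j := s j - 1)"
    and pq: "p \<in> I" "q \<in> I" "p \<noteq> q" "c \<le> (s' p + s' q - 1) * prod s' (I - {p, q})"
  obtains p' where "p' \<in> I" "p' \<noteq> w" "c + prod s (I - {j, w}) \<le> (s p' + s w - 1) * prod s (I - {p', w})"
proof -
  have s'_pos: "1 \<le> s' i" if "i \<in> I" for i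
    using s(1)[OF that] s(3) by (auto simp: s')
  have "\<exists>p'. p' \<in> I \<and> p' \<noteq> w \<and> c \<le> (s' p' + s' w - 1) * prod s' (I - {p', w})"
  proof -
    \<comment> \<open>Since \<open>w\<close> is smallest only among the classes other than
      \<open>j\<close>, it may replace only a member of the pair different from \<open>j\<close>. As
      \<open>p \<noteq> q\<close>, there is one.\<close>
    consider "p = w" | "q = w" | "p \<noteq> w" "q \<noteq> w" "q \<noteq> j" | "p \<noteq> w" "q \<noteq> w" "p \<noteq> j"
      using pq(3) by blast
    then show ?thesis
    proof cases
      case 1
      then show ?thesis
        using pq by (intro exI[of _ q]) (auto simp: insert_commute add.commute)
    next
      case 2
      then show ?thesis
        using pq by blast
    next
      case 3
      then have "s' w \<le> s' q"
        using s(2)[OF pq(2)] I(4) by (auto simp: s')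
      then show ?thesis
        using merged_prod_exchange[of I p q w s'] I pq 3 s'_pos[OF pq(1)] order_trans by blast
    next
      case 4
      then have "s' w \<le> s' p"
        using s(2)[OF pq(1)] I(4) by (auto simp: s')
      then have "(s' q + s' p - 1) * prod s' (I - {q, p}) \<le> (s' q + s' w - 1) * prod s' (I - {q, w})"
        using merged_prod_exchange[of I q p w s'] I pq 4 s'_pos[OF pq(2)] by blast
      then show ?thesis
        using pq 4 by (intro exI[of _ q]) (auto simp: insert_commute add.commute)
    qed
  qed
  then obtain p' where p': "p' \<in> I" "p' \<noteq> w" "c \<le> (s' p' + s' w - 1) * prod s' (I - {p', w})"
    by blast
  have sw: "s' w = s w" "1 \<le> s w"
    using I s(1) by (auto simp: s')
  have "c + prod s (I - {j, w}) \<le> (s p' + s w - 1) * prod s (I - {p', w})"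
  \<comment> \<open>If \<open>j\<close> belongs to the merged pair, the merged factor grows by one.
    Otherwise the separate factor \<open>s j\<close> grows by one, and the gain suffices because
    \<open>s p' \<le> s p' + s w - 1\<close>.\<close>
  proof (cases "p' = j")
    case True
    have "prod s' (I - {j, w}) = prod s (I - {j, w})"
      by (intro prod.cong) (auto simp: s')
    then have "c \<le> (s' j + s' w - 1) * prod s (I - {j, w})"
      using p'(3) True by simp
    moreover have "s j + s w - 1 = Suc (s' j + s' w - 1)"
      using s(3) sw by (simp add: s')
    ultimately show ?thesis
      by (simp add: True)
  next
    case False
    let ?R = "prod s (I - {j, p', w})"
    have "prod s' (I - {j, p', w}) = ?R"
      by (intro prod.cong) (auto simp: s')
    then have 1: "prod s' (I - {p', w}) = (s j - 1) * ?R"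
      using prod_Diff_insert[of I j "{p', w}" s'] I False by (simp add: s')
    have 2: "prod s (I - {p', w}) = s j * ?R"
      using prod_Diff_insert[of I j "{p', w}" s] I False by simp
    have 3: "prod s (I - {j, w}) = s p' * ?R"
      using prod_Diff_insert[of I p' "{j, w}" s] I False p' by (simp add: insert_commute)
    have "s' p' = s p'"
      using False by (simp add: s')
    then have "c + prod s (I - {j, w}) \<le> (s p' + s w - 1) * ((s j - 1) * ?R) + s p' * ?R"
      using p'(3) by (simp add: 1 3 sw)
    also have "\<dots> \<le> (s p' + s w - 1) * ((s j - 1) * ?R) + (s p' + s w - 1) * ?R"
      by (intro add_left_mono mult_le_mono1) (use sw in linarith)
    also have "\<dots> = (s p' + s w - 1) * (((s j - 1) + 1) * ?R)"
      by (simp only: distrib_left distrib_right mult_1)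
    also have "(s j - 1) + 1 = s j"
      using s(3) by simp
    finally show ?thesis
      by (simp only: 2)
  qed
  then show ?thesis
    using that p' by blast
qed

text \<open>These are the cycles of a coloured digraph, each written as the function from colours to
  its vertices. Starting at colour 0 removes the ambiguity of rotation.\<close>

definition transversals :: "'a set \<Rightarrow> ('a \<times> 'a) set \<Rightarrow> ('a \<Rightarrow> nat) \<Rightarrow> nat \<Rightarrow> (nat \<Rightarrow> 'a) set" where
  "transversals V E col k =
     {g \<in> \<Pi>\<^sub>E i\<in>{..<k}. {v \<in> V. col v = i}. \<forall>i<k. (g i, g (Suc i mod k)) \<in> E}"

lemma vcycle_transversal:
  assumes "g \<in> transversals V E col k" "0 < k"
  shows "vcycle E (map g [0..<k])"
proof -
  have "col (g i) = i" if "i < k" for i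
    using assms(1) that by (auto simp: transversals_def)
  then have "inj_on g {..<k}"
    by (metis inj_onI lessThan_iff)
  then show ?thesis
    using assms by (auto simp: vcycle_conv_nth distinct_map transversals_def atLeast0LessThan)
qed

section \<open>Transversals through a vertex, and deletion of that vertex\<close>

context coloured_digraph
begin

definition cls :: "nat \<Rightarrow> 'a set" where
  "cls i = {v \<in> V. col v = i}"

lemma finite_transversals: "finite (transversals V E col k)"
proof (rule finite_subset)
  show "transversals V E col k \<subseteq> (\<Pi>\<^sub>E i\<in>{..<k}. {v \<in> V. col v = i})"
    by (auto simp: transversals_def)
qed (use finite_V in \<open>auto intro: finite_PiE\<close>)

lemma coloured_digraph_delete:
  "coloured_digraph (V - {x}) (Restr E (V - {x})) col k"
proof
  show "length vs = k" if "vcycle (Restr E (V - {x})) vs" for vs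
    using that vcycle_mono length_vcycle by (metis inf_le1)
qed (use finite_V k_ge col_less col_arc in auto)

text \<open>Forgetting the coordinate \<open>col x\<close>, which is always \<open>x\<close>, is
  injective on the cycles through \<open>x\<close>. Since these cycles meet outside
  \<open>x\<close>, it turns them into an intersecting family in the product of the other
  classes.\<close>

lemma card_transversals_through:
  assumes x: "x \<in> V" "\<And>p q. vcycle E (x # p) \<Longrightarrow> vcycle E (x # q) \<Longrightarrow> set p \<inter> set q \<noteq> {}"
    and m: "\<And>i. i < k \<Longrightarrow> i \<noteq> col x \<Longrightarrow> m \<le> card (cls i)"
  shows "m * card {g \<in> transversals V E col k. g (col x) = x} \<le> (\<Prod>i\<in>{..<k} - {col x}. card (cls i))"
proof -
  let ?F = "{g \<in> transversals V E col k. g (col x) = x}" and ?I = "{..<k} - {col x}"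
  have F: "g \<in> (\<Pi>\<^sub>E i\<in>{..<k}. cls i)" "g (col x) = x" if "g \<in> ?F" for g
    using that by (auto simp: transversals_def cls_def)
  have meet: "\<exists>i\<in>?I. g i = h i" if gh: "g \<in> ?F" "h \<in> ?F" for g h
  proof -
    have *: "\<exists>p. vcycle E (x # p) \<and> (\<forall>y\<in>set p. y \<noteq> x \<and> col y < k \<and> f (col y) = y)"
      if f: "f \<in> ?F" for f
    proof -
      have "vcycle E (map f [0..<k])"
        using f k_ge by (intro vcycle_transversal) auto
      moreover have "x \<in> set (map f [0..<k])"
        using F(2)[OF f] col_less[OF x(1)] by force
      ultimately obtain p where p: "vcycle E (x # p)" "set (x # p) = set (map f [0..<k])"
        by (metis vcycle_rotate_to)
      have "y \<noteq> x \<and> col y < k \<and> f (col y) = y" if "y \<in> set p" for y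
      proof -
        have "y \<in> set (map f [0..<k])"
          using p(2) that by (metis list.set_intros(2))
        then obtain i where "i < k" "y = f i"
          by auto
        moreover have "col (f i) = i"
          using F(1)[OF f] \<open>i < k\<close> by (auto simp: cls_def)
        ultimately show ?thesis
          using p(1) that by (auto simp: vcycle_def)
      qed
      then show ?thesis
        using p(1) by blast
    qed
    obtain p q where p: "vcycle E (x # p)" "\<forall>y\<in>set p. y \<noteq> x \<and> col y < k \<and> g (col y) = y"
      and q: "vcycle E (x # q)" "\<forall>y\<in>set q. y \<noteq> x \<and> col y < k \<and> h (col y) = y"
      using *[OF gh(1)] *[OF gh(2)] by blast
    obtain y where y: "y \<in> set p" "y \<in> set q"
      using x(2)[OF p(1) q(1)] by blast
    then have "g (col y) = h (col y)" "col y < k" "y \<noteq> x" "g (col y) = y"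
      using p(2) q(2) by auto
    moreover have "col y \<noteq> col x"
      using calculation F(2)[OF gh(1)] by metis
    ultimately show ?thesis
      by blast
  qed
  have "inj_on (\<lambda>g. restrict g ?I) ?F"
  proof (rule inj_onI)
    fix g h
    assume gh: "g \<in> ?F" "h \<in> ?F" "restrict g ?I = restrict h ?I"
    show "g = h"
    proof (rule PiE_ext[OF F(1)[OF gh(1)] F(1)[OF gh(2)]])
      fix i
      assume "i \<in> {..<k}"
      then show "g i = h i"
        using fun_cong[OF gh(3), of i] F(2)[OF gh(1)] F(2)[OF gh(2)] by (cases "i = col x") auto
    qed
  qed
  then have "card ?F = card ((\<lambda>g. restrict g ?I) ` ?F)"
    by (simp add: card_image)
  moreover have "m * card ((\<lambda>g. restrict g ?I) ` ?F) \<le> (\<Prod>i\<in>?I. card (cls i))"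
  proof (rule card_intersecting_PiE_le)
    show "(\<lambda>g. restrict g ?I) ` ?F \<subseteq> (\<Pi>\<^sub>E i\<in>?I. cls i)"
    proof (rule image_subsetI)
      fix g
      assume "g \<in> ?F"
      then show "restrict g ?I \<in> (\<Pi>\<^sub>E i\<in>?I. cls i)"
        using F(1) by (intro restrict_PiE_iff[THEN iffD2]) auto
    qed
    show "\<exists>i\<in>?I. g i = h i"
      if "g \<in> (\<lambda>g. restrict g ?I) ` ?F" "h \<in> (\<lambda>g. restrict g ?I) ` ?F" for g h
      using that meet by fastforce
  qed (use m finite_V in \<open>auto simp: cls_def\<close>)
  ultimately show ?thesis
    by simp
qed

text \<open>A transversal can contain \<open>x\<close> only at the colour of
  \<open>x\<close>.\<close>

lemma transversals_delete:
  "transversals V E col k \<subseteq>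
     transversals (V - {x}) (Restr E (V - {x})) col k \<union> {g \<in> transversals V E col k. g (col x) = x}"
proof
  fix g
  assume g: "g \<in> transversals V E col k"
  show "g \<in> transversals (V - {x}) (Restr E (V - {x})) col k \<union> {g \<in> transversals V E col k. g (col x) = x}"
  proof (cases "g (col x) = x")
    case False
    have *: "g i \<in> V \<and> col (g i) = i" if "i < k" for i
      using g that by (auto simp: transversals_def)
    then have "g i \<in> V - {x} \<and> col (g i) = i" if "i < k" for i
      using *[OF that] False by auto
    moreover have "Suc i mod k < k" for i
      using k_ge by simp
    ultimately show ?thesis
      using g by (auto simp: transversals_def PiE_iff)
  qed (use g in simp)
qed

end

text \<open>
  Merging the two smallest colour classes into one that is smaller by one vertex maximises the
  right-hand side, and it is this form of the bound that survives the deletion of a vertex.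
\<close>

lemma card_transversals_le:
  assumes "coloured_digraph V E col k"
  shows "\<exists>p q. p < k \<and> q < k \<and> p \<noteq> q \<and> card (transversals V E col k) \<le>
    (card {v \<in> V. col v = p} + card {v \<in> V. col v = q} - 1)
      * (\<Prod>i\<in>{..<k} - {p, q}. card {v \<in> V. col v = i})"
  using assms
proof (induction "card V" arbitrary: V E rule: less_induct)
  case less
  interpret coloured_digraph V E col k
    by fact
  define s where "s i = card (cls i)" for i
  let ?I = "{..<k}"
  show ?case
  \<comment> \<open>Without transversals any pair of classes works. Otherwise all classes are
    nonempty, as the cancellation and the exchange argument require.\<close>
  proof (cases "transversals V E col k = {}")
    case True
    then show ?thesis
      using k_ge by (intro exI[of _ 0] exI[of _ 1]) auto
  next
    case False
    then obtain g where "g \<in> transversals V E col k"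
      by blast
    then have "g i \<in> cls i" if "i < k" for i
      using that by (auto simp: transversals_def cls_def)
    then have s_pos: "1 \<le> s i" if "i < k" for i
      using that finite_V unfolding s_def cls_def
      by (metis (no_types, lifting) One_nat_def Suc_leI card_gt_0_iff empty_iff finite_Collect_conjI
          finite_subset mem_Collect_eq subsetI)
    then have "cls 0 \<noteq> {}"
      using k_ge by (force simp: s_def)
    then have "V \<noteq> {}"
      by (auto simp: cls_def)
    then obtain x where x: "x \<in> V" "\<And>p q. vcycle E (x # p) \<Longrightarrow> vcycle E (x # q) \<Longrightarrow> set p \<inter> set q \<noteq> {}"
      using ex_intersecting_vertex by blast
    define j where "j = col x"
    have j: "j < k"
      using x col_less by (simp add: j_def)
    let ?F = "{g \<in> transversals V E col k. g (col x) = x}"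
      and ?V' = "V - {x}" and ?E' = "Restr E (V - {x})"
    have "?I - {j} \<noteq> {}"
    proof
      assume "?I - {j} = {}"
      then have "0 = j" "1 = j"
        using k_ge by (auto simp: subset_iff)
      then show False
        by simp
    qed
    then have "Min (s ` (?I - {j})) \<in> s ` (?I - {j})"
      by (intro Min_in) auto
    then obtain w where "Min (s ` (?I - {j})) = s w" "w \<in> ?I - {j}"
      by (rule imageE)
    then have w: "w < k" "w \<noteq> j" "s w = Min (s ` (?I - {j}))"
      by auto
    have w_min: "s w \<le> s i" if "i < k" "i \<noteq> j" for i
      unfolding w(3) using that by (intro Min_le) auto
    \<comment> \<open>The smallest class other than \<open>j\<close> supplies the largest admissible
      number of shifts; its size then cancels against one factor of the product.\<close>
    have "s w * card ?F \<le> prod s (?I - {j})"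
      using card_transversals_through[OF x, of "s w"] w_min by (simp add: s_def j_def)
    also have "\<dots> = s w * prod s (?I - {j, w})"
      using prod_Diff_insert[of ?I w "{j}" s] w by (simp add: insert_commute)
    finally have F_le: "card ?F \<le> prod s (?I - {j, w})"
      using s_pos[OF w(1)] by simp
    let ?T' = "transversals ?V' ?E' col k"
    interpret del: coloured_digraph ?V' ?E' col k
      by (rule coloured_digraph_delete)
    have "card (transversals V E col k) \<le> card (?T' \<union> ?F)"
      using transversals_delete[of x] finite_transversals del.finite_transversals
      by (intro card_mono) auto
    also have "\<dots> \<le> card ?T' + card ?F"
      by (rule card_Un_le)
    finally have T_le: "card (transversals V E col k) \<le> card ?T' + prod s (?I - {j, w})"
      using F_le by simp
    have "\<exists>p q. p < k \<and> q < k \<and> p \<noteq> q \<and>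
        card (transversals V E col k) \<le> (s p + s q - 1) * prod s (?I - {p, q})"
    \<comment> \<open>If \<open>x\<close> is alone in its class, no transversal survives its
      deletion, and the bound for \<open>?F\<close> alone suffices with the pair \<open>j\<close>,
      \<open>w\<close>.\<close>
    proof (cases "s j = 1")
      case True
      then obtain y where "cls j = {y}"
        unfolding s_def by (metis card_1_singletonE)
      moreover have "x \<in> cls j"
        using x(1) by (simp add: cls_def j_def)
      ultimately have "cls j = {x}"
        by simp
      then have "{v \<in> ?V'. col v = j} = {}"
        by (auto simp: cls_def)
      then have "?T' = {}"
        using j by (auto simp: transversals_def PiE_eq_empty_iff)
      then have "card (transversals V E col k) \<le> prod s (?I - {j, w})"
        using T_le by simp
      also have "\<dots> \<le> (s j + s w - 1) * prod s (?I - {j, w})"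
        using True s_pos[OF w(1)] by simp
      finally show ?thesis
        using j w by metis
    next
      case False
      define s' where "s' = s(j := s j - 1)"
      have cls': "card {v \<in> ?V'. col v = i} = s' i" for i
      proof (cases "i = j")
        case True
        then have "{v \<in> ?V'. col v = i} = cls j - {x}" "x \<in> cls j"
          using x(1) by (auto simp: cls_def j_def)
        then show ?thesis
          using True by (simp add: s'_def s_def)
      next
        case False
        then have "{v \<in> ?V'. col v = i} = cls i"
          by (auto simp: cls_def j_def)
        then show ?thesis
          using False by (simp add: s'_def s_def)
      qed
      have "card ?V' < card V"
        using x(1) finite_V by (intro psubset_card_mono) auto
      from less.hyps[OF this coloured_digraph_delete]
      obtain p q where pq: "p < k" "q < k" "p \<noteq> q"
        "card ?T' \<le> (s' p + s' q - 1) * prod s' (?I - {p, q})"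
        unfolding cls' by blast
      have "2 \<le> s j"
        using False s_pos[OF j] by simp
      then obtain p' where "p' \<in> ?I" "p' \<noteq> w"
        "card ?T' + prod s (?I - {j, w}) \<le> (s p' + s w - 1) * prod s (?I - {p', w})"
        using merged_prod_step[of ?I j w s s' p q "card ?T'"] j w(1,2) s_pos w_min pq s'_def by auto
      then show ?thesis
        using T_le w(1) by (meson lessThan_iff order_trans)
    qed
    then show ?thesis
      unfolding s_def cls_def .
  qed
qed

section \<open>Directed cycles of a digraph\<close>

lemma pcas_iff:
  "p \<noteq> [] \<Longrightarrow> pcas u p v \<longleftrightarrow>
     fst (hd p) = u \<and> snd (last p) = v \<and> successively (\<lambda>e f. snd e = fst f) p"
proof (induction p arbitrary: u)
  case (Cons e p)
  show ?case
  proof (cases "p = []")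
    case False
    then have "pcas u (e # p) v \<longleftrightarrow> fst e = u \<and> fst (hd p) = snd e \<and> snd (last p) = v \<and>
        successively (\<lambda>e f. snd e = fst f) p"
      using Cons.IH[OF False, of "snd e"] by simp
    then show ?thesis
      using False by (auto simp add: successively_Cons simp del: pcas.simps)
  qed auto
qed simp

lemma pawalk_verts_pcas: "pcas u p v \<Longrightarrow> pawalk_verts u p = u # map snd p"
  by (induction p arbitrary: u) auto

text \<open>The tails of the arcs form \<open>vs\<close> and the heads form its rotation.
  Distinctness in the library's sense concerns the heads, hence is equivalent to distinctness of
  \<open>vs\<close>.\<close>

lemma cycle_iff_vcycle:
  assumes "pair_wf_digraph G"
  shows "pre_digraph.cycle (with_proj G) p \<longleftrightarrow> (\<exists>vs. vcycle (parcs G) vs \<and> p = zip vs (rotate1 vs))"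
proof
  assume "pre_digraph.cycle (with_proj G) p"
  then obtain u where u: "set p \<subseteq> parcs G" "pcas u p u" "distinct (tl (pawalk_verts u p))" "p \<noteq> []"
    by (auto simp: pre_digraph.cycle_def pre_digraph.awalk_def cas_with_proj_eq
        awalk_verts_with_proj_eq)
  let ?n = "length p" and ?vs = "map fst p"
  have cas: "fst (hd p) = u" "snd (last p) = u" "successively (\<lambda>e f. snd e = fst f) p"
    using pcas_iff[OF u(4)] u(2) by auto
  have nxt: "snd (p ! i) = fst (p ! (Suc i mod ?n))" if "i < ?n" for i
  proof (cases "Suc i = ?n")
    case True
    then have "p ! i = last p" "p ! (Suc i mod ?n) = hd p"
      using u(4) by (auto simp: last_conv_nth hd_conv_nth simp flip: True)
    then show ?thesis
      using cas by simp
  next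
    case False
    then show ?thesis
      using cas(3) that by (simp add: successively_conv_nth)
  qed
  have snd_eq: "map snd p = rotate1 ?vs"
    by (rule nth_equalityI) (use nxt u(4) in \<open>auto simp: nth_rotate1\<close>)
  have "distinct (map snd p)"
    using u(3) pawalk_verts_pcas[OF u(2)] by simp
  then have "distinct ?vs"
    unfolding snd_eq by simp
  moreover have "(?vs ! i, ?vs ! (Suc i mod length ?vs)) \<in> parcs G" if "i < length ?vs" for i
  proof -
    have "Suc i mod ?n < ?n"
      using u(4) by simp
    then have "(?vs ! i, ?vs ! (Suc i mod length ?vs)) = p ! i"
      using nxt[of i] that by (simp add: prod_eq_iff)
    then show ?thesis
      using u(1) that by auto
  qed
  ultimately have "vcycle (parcs G) ?vs"
    using u(4) by (simp add: vcycle_conv_nth)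
  moreover have "p = zip ?vs (rotate1 ?vs)"
    by (simp only: snd_eq[symmetric] zip_map_fst_snd)
  ultimately show "\<exists>vs. vcycle (parcs G) vs \<and> p = zip vs (rotate1 vs)"
    by blast
next
  assume "\<exists>vs. vcycle (parcs G) vs \<and> p = zip vs (rotate1 vs)"
  then obtain vs where vs: "vcycle (parcs G) vs" and p: "p = zip vs (rotate1 vs)"
    by blast
  have ne: "vs \<noteq> []" "p \<noteq> []" and len: "length p = length vs"
    using vs by (auto simp: vcycle_def p)
  have nth_p: "p ! i = (vs ! i, vs ! (Suc i mod length vs))" if "i < length vs" for i
    using that by (simp add: p nth_rotate1)
  have arcs: "set p \<subseteq> parcs G"
    using vs len nth_p by (auto simp: in_set_conv_nth vcycle_conv_nth)
  have fst_p: "map fst p = vs" and snd_p: "map snd p = rotate1 vs"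
    by (auto simp: p)
  have "fst (hd p) = hd vs"
    using fst_p ne by (metis hd_map)
  moreover have "snd (last p) = hd vs"
    using snd_p ne by (metis last_map last_snoc list.collapse rotate1.simps(2))
  moreover have "successively (\<lambda>e f. snd e = fst f) p"
    by (simp add: successively_conv_nth nth_p len)
  ultimately have cas: "pcas (hd vs) p (hd vs)"
    using pcas_iff[OF ne(2)] by blast
  have "hd vs \<in> pverts G"
    using vs pair_wf_digraph.in_arcsD2[OF assms] by (auto simp: vcycle_def)
  moreover have "distinct (tl (pawalk_verts (hd vs) p))"
    using pawalk_verts_pcas[OF cas] vs by (simp add: snd_p vcycle_def)
  ultimately show "pre_digraph.cycle (with_proj G) p"
    using arcs cas ne unfolding pre_digraph.cycle_def pre_digraph.awalk_def
    by (auto simp: cas_with_proj_eq awalk_verts_with_proj_eq)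
qed

text \<open>Taking a function on indices modulo \<open>m\<close> lets vertex lists, through
  \<open>(!)\<close>, and transversals share one notion of arc set.\<close>

definition closed_arcs :: "nat \<Rightarrow> (nat \<Rightarrow> 'a) \<Rightarrow> ('a \<times> 'a) set" where
  "closed_arcs m g = (\<lambda>i. (g i, g (Suc i mod m))) ` {..<m}"

lemma set_zip_rotate1: "set (zip vs (rotate1 vs)) = closed_arcs (length vs) ((!) vs)"
  by (auto simp: closed_arcs_def set_zip nth_rotate1 image_iff)

lemma directed_cycles_conv_vcycle:
  assumes "pair_digraph G"
  shows "directed_cycles G = {closed_arcs (length vs) ((!) vs) | vs. vcycle (parcs G) vs}"
proof -
  interpret pair_digraph G
    by fact
  show ?thesis
    using cycle_iff_vcycle[OF pair_wf_digraph_axioms]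
    by (fastforce simp: directed_cycles_def set_zip_rotate1[symmetric])
qed

lemma cycle_digraph_conv_vcycle:
  "cycle_digraph L G \<longleftrightarrow> pair_digraph G \<and> (\<forall>vs. vcycle (parcs G) vs \<longrightarrow> length vs \<in> L)"
proof (cases "pair_digraph G")
  case True
  then interpret pair_digraph G .
  have "length (zip vs (rotate1 vs)) = length vs" for vs :: "'a list"
    by simp
  then show ?thesis
    unfolding cycle_digraph_def cycle_iff_vcycle[OF pair_wf_digraph_axioms] by metis
qed (simp add: cycle_digraph_def)

lemma finite_directed_cycles:
  assumes "pair_digraph G"
  shows "finite (directed_cycles G)"
proof (rule finite_subset)
  show "directed_cycles G \<subseteq> Pow (parcs G)"
    by (auto simp: directed_cycles_def pre_digraph.cycle_def pre_digraph.awalk_def)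
  show "finite (Pow (parcs G))"
    using assms by (simp add: pair_digraph_def pair_fin_digraph_def pair_fin_digraph_axioms_def)
qed

text \<open>The index \<open>i\<close> is unbounded, so that going once around,
  \<open>i = length vs\<close>, shows that \<open>k\<close> divides the length.\<close>

lemma vcycle_col_nth:
  assumes vs: "vcycle E vs" and arc: "\<And>u v. (u, v) \<in> E \<Longrightarrow> col v = Suc (col u) mod k"
  shows "col (vs ! (i mod length vs)) = (col (vs ! 0) + i) mod k"
proof (induction i)
  \<comment> \<open>The first vertex is the head of the closing arc, so its colour is already
    reduced modulo \<open>k\<close>.\<close>
  case 0
  have "(last vs, hd vs) \<in> E" "vs \<noteq> []"
    using vs by (auto simp: vcycle_def)
  then have "col (vs ! 0) = Suc (col (last vs)) mod k"
    using arc by (simp add: hd_conv_nth)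
  then show ?case
    by (simp add: mod_mod_trivial)
next
  case (Suc i)
  have "length vs > 0"
    using vs by (simp add: vcycle_def)
  then have "i mod length vs < length vs"
    by simp
  then have "(vs ! (i mod length vs), vs ! (Suc (i mod length vs) mod length vs)) \<in> E"
    using vs by (simp add: vcycle_conv_nth)
  then show ?case
    using arc Suc by (fastforce simp: mod_Suc_eq)
qed

text \<open>Every arc of a cycle has a way back along the cycle, so no cycle is lost in
  \<open>E'\<close>. Rotating the cycle to start at colour 0 makes it a transversal.\<close>

lemma directed_cycles_subset_transversals:
  assumes G: "cycle_digraph {k} G" and k: "0 < k"
    and col: "\<And>u. col u < k"
    and E': "E' = {(u, v) \<in> parcs G. (v, u) \<in> (parcs G)\<^sup>*}"
    and arc: "\<And>u v. (u, v) \<in> E' \<Longrightarrow> col v = Suc (col u) mod k"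
  shows "directed_cycles G \<subseteq> closed_arcs k ` transversals (pverts G) E' col k"
proof
  interpret pair_digraph G
    using G by (simp add: cycle_digraph_def)
  fix D
  assume "D \<in> directed_cycles G"
  then obtain vs where D: "D = closed_arcs (length vs) ((!) vs)" and vs: "vcycle (parcs G) vs"
    using directed_cycles_conv_vcycle[OF pair_digraph_axioms] by auto
  have len: "length vs = k"
    using G vs by (simp add: cycle_digraph_conv_vcycle)
  have arcs: "(vs ! i, vs ! (Suc i mod k)) \<in> E'" if "i < k" for i
    using vs vcycle_connected[OF vs] that k len by (auto simp: E' vcycle_conv_nth)
  then have vs': "vcycle E' vs"
    using vs len by (simp add: vcycle_conv_nth)
  define c where "c = col (vs ! 0)"
  have "c < k"
    using col by (simp add: c_def)
  have col_vs: "col (vs ! (i mod k)) = (c + i) mod k" for i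
    using vcycle_col_nth[OF vs' arc, where i = i] by (simp add: c_def len)
  \<comment> \<open>As \<open>vs\<close> starts at colour \<open>c\<close>, its vertex at index
    \<open>(i + (k - c)) mod k\<close> has colour \<open>i\<close>.\<close>
  define g where "g = (\<lambda>i\<in>{..<k}. vs ! ((i + (k - c)) mod k))"
  have g_nxt: "g (Suc i mod k) = vs ! (Suc ((i + (k - c)) mod k) mod k)" if "i < k" for i
  proof -
    have "(Suc i mod k + (k - c)) mod k = Suc ((i + (k - c)) mod k) mod k"
      by (metis add_Suc mod_Suc_eq mod_add_left_eq)
    then show ?thesis
      using k by (simp add: g_def)
  qed
  have g_arc: "(g i, g (Suc i mod k)) = (vs ! ((i + (k - c)) mod k), vs ! (Suc ((i + (k - c)) mod k) mod k))"
    if "i < k" for i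
    using that g_nxt[OF that] by (simp add: g_def)
  have g_col: "col (g i) = i" if "i < k" for i
  proof -
    have "col (g i) = (c + (i + (k - c))) mod k"
      using col_vs that by (simp add: g_def)
    also have "c + (i + (k - c)) = i + k"
      using \<open>c < k\<close> by simp
    finally show ?thesis
      using that by simp
  qed
  have g_E': "(g i, g (Suc i mod k)) \<in> E'" if "i < k" for i
    unfolding g_arc[OF that] using arcs k by simp
  have "g i \<in> pverts G" if "i < k" for i
    using g_E'[OF that] in_arcsD1 by (auto simp: E')
  then have "g \<in> transversals (pverts G) E' col k"
    using g_col g_E' by (auto simp: transversals_def g_def)
  moreover have "D = closed_arcs k g"
  proof -
    \<comment> \<open>Rotation by \<open>k - c\<close> permutes the indices, with rotation by
      \<open>c\<close> as inverse, so the set of arcs is unchanged.\<close>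
    have "(\<lambda>i. (i + (k - c)) mod k) ` {..<k} = {..<k}"
    proof
      show "{..<k} \<subseteq> (\<lambda>i. (i + (k - c)) mod k) ` {..<k}"
      proof
        fix i
        assume "i \<in> {..<k}"
        moreover have "((i + c) mod k + (k - c)) mod k = (i + k) mod k"
          using \<open>c < k\<close> by (metis add.assoc add_diff_inverse_nat less_imp_not_less mod_add_left_eq)
        ultimately show "i \<in> (\<lambda>i. (i + (k - c)) mod k) ` {..<k}"
          using k by (intro image_eqI[of _ _ "(i + c) mod k"]) auto
      qed
    qed (use k in auto)
    then have "D = (\<lambda>i. (vs ! i, vs ! (Suc i mod k))) ` (\<lambda>i. (i + (k - c)) mod k) ` {..<k}"
      by (simp add: D closed_arcs_def len)
    also have "\<dots> = closed_arcs k g"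
      unfolding closed_arcs_def image_image by (intro image_cong) (simp_all only: g_arc lessThan_iff)
    finally show ?thesis .
  qed
  ultimately show "D \<in> closed_arcs k ` transversals (pverts G) E' col k"
    by blast
qed

lemma card_directed_cycles_le_prod:
  assumes G: "cycle_digraph {k} G" and k: "2 \<le> k" "k \<le> card (pverts G)"
  shows "card (directed_cycles G) \<le> (\<Prod>i<k - 1. (card (pverts G) - 1 + i) div (k - 1))"
proof -
  interpret pair_digraph G
    using G by (simp add: cycle_digraph_def)
  have len: "length vs = k" if "vcycle (parcs G) vs" for vs
    using G that by (simp add: cycle_digraph_conv_vcycle)
  have "0 < k"
    using k by simp
  then obtain col :: "'a \<Rightarrow> nat" where col: "\<And>u. col u < k"
    "\<And>u v. (u, v) \<in> parcs G \<Longrightarrow> (v, u) \<in> (parcs G)\<^sup>* \<Longrightarrow> col v = Suc (col u) mod k"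
    using ex_colouring[OF len] by blast
  \<comment> \<open>The colouring is controlled only on arcs inside strong components, so only these
    are kept.\<close>
  define E' where "E' = {(u, v) \<in> parcs G. (v, u) \<in> (parcs G)\<^sup>*}"
  have arc: "col v = Suc (col u) mod k" if "(u, v) \<in> E'" for u v
    using that col(2) by (auto simp: E'_def)
  have "E' \<subseteq> parcs G"
    by (auto simp: E'_def)
  have coloured: "coloured_digraph (pverts G) E' col k"
  proof
    show "length vs = k" if "vcycle E' vs" for vs
      using that vcycle_mono[OF _ \<open>E' \<subseteq> parcs G\<close>] len by blast
    show "E' \<subseteq> pverts G \<times> pverts G"
      using in_arcsD1 in_arcsD2 by (auto simp: E'_def)
  qed (use col arc k pair_finite_verts in auto)
  define s where "s i = card {v \<in> pverts G. col v = i}" for i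
  define n where "n = card (pverts G)"
  let ?T = "transversals (pverts G) E' col k"
  obtain p q where pq: "p < k" "q < k" "p \<noteq> q"
    "card ?T \<le> (s p + s q - 1) * prod s ({..<k} - {p, q})"
    using card_transversals_le[OF coloured] unfolding s_def by blast
  have "card (directed_cycles G) \<le> card (closed_arcs k ` ?T)"
    using directed_cycles_subset_transversals[OF G \<open>0 < k\<close> col(1) E'_def arc]
      coloured_digraph.finite_transversals[OF coloured] by (intro card_mono) auto
  also have "\<dots> \<le> card ?T"
    by (rule card_image_le) (rule coloured_digraph.finite_transversals[OF coloured])
  also note pq(4)
  also have "(s p + s q - 1) * prod s ({..<k} - {p, q}) \<le> (\<Prod>i<k - 1. (n - 1 + i) div (k - 1))"
  \<comment> \<open>If both classes are empty, truncated subtraction makes the left side 0;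
    otherwise the merged class really loses one vertex.\<close>
  proof (cases "s p + s q = 0")
    case False
    let ?I = "{..<k} - {q}"
    \<comment> \<open>Class \<open>q\<close> is absorbed into class \<open>p\<close> with one vertex
      less, leaving \<open>k - 1\<close> numbers with sum \<open>n - 1\<close>.\<close>
    define a where "a = s(p := s p + s q - 1)"
    have I: "finite ?I" "p \<in> ?I" "?I - {p} = {..<k} - {p, q}" "card ?I = k - 1"
      using pq by auto
    have "sum s {..<k} = (\<Sum>v\<in>pverts G. 1)"
      unfolding s_def card_eq_sum using pair_finite_verts col(1) by (intro sum.group) auto
    then have "sum s {..<k} = n"
      by (simp add: n_def)
    then have "s q + (s p + sum s ({..<k} - {p, q})) = n"
      using sum.remove[of "{..<k}" q s] sum.remove[of ?I p s] pq I by simp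
    moreover have "sum a ?I = (s p + s q - 1) + sum s ({..<k} - {p, q})"
      using sum.remove[of ?I p a] I by (auto simp: a_def intro!: sum.cong)
    ultimately have sum_a: "sum a ?I = n - 1"
      using False by linarith
    have "prod a ?I = (s p + s q - 1) * prod s ({..<k} - {p, q})"
      using prod.remove[of ?I p a] I by (auto simp: a_def intro!: prod.cong)
    moreover have "prod a ?I \<le> (\<Prod>i<card ?I. (sum a ?I + i) div card ?I)"
      using I k by (intro prod_le_balanced) (auto simp: sum_a n_def)
    ultimately show ?thesis
      by (simp only: sum_a I(4))
  qed simp
  finally show ?thesis
    by (simp only: n_def)
qed

section \<open>The extremal digraph\<close>

text \<open>Vertex 0 is the only one of colour 0; the others receive the colours 1 to
  \<open>k - 1\<close> cyclically, which balances the classes.\<close>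

definition blowup_col :: "nat \<Rightarrow> nat \<Rightarrow> nat" where
  "blowup_col k v = (if v = 0 then 0 else Suc ((v - 1) mod (k - 1)))"

definition blowup :: "nat \<Rightarrow> nat \<Rightarrow> nat pair_pre_digraph" where
  "blowup k n = \<lparr>pverts = {..<n},
     parcs = {(u, v). u < n \<and> v < n \<and> blowup_col k v = Suc (blowup_col k u) mod k}\<rparr>"

lemma blowup_col_less:
  assumes "2 \<le> k"
  shows "blowup_col k v < k"
proof -
  have "(v - 1) mod (k - 1) < k - 1"
    by (rule mod_less_divisor) (use assms in simp)
  then have "Suc ((v - 1) mod (k - 1)) < k"
    by linarith
  then show ?thesis
    unfolding blowup_col_def using assms by simp
qed

text \<open>Going around a cycle returns to the same colour, so \<open>k\<close> divides its length.
  Length at least \<open>2 * k\<close> would mean two visits to vertex 0, the only vertex of colour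
  0.\<close>

lemma cycle_digraph_blowup:
  assumes "2 \<le> k"
  shows "cycle_digraph {k} (blowup k n)"
  unfolding cycle_digraph_conv_vcycle
proof (intro conjI allI impI)
  have "x \<noteq> Suc x mod k" if "x < k" for x
    using that assms by (cases "Suc x = k") auto
  then show "pair_digraph (blowup k n)"
    using blowup_col_less[OF assms]
    by unfold_locales (auto simp: blowup_def intro: finite_subset[of _ "{..<n} \<times> {..<n}"])
next
  fix vs
  assume vs: "vcycle (parcs (blowup k n)) vs"
  let ?l = "length vs" and ?c = "blowup_col k (vs ! 0)"
  have c: "?c < k"
    using blowup_col_less[OF assms] .
  have "vs \<noteq> []"
    using vs by (simp add: vcycle_def)
  have col: "blowup_col k (vs ! (i mod ?l)) = (?c + i) mod k" for i
    by (rule vcycle_col_nth[OF vs]) (simp add: blowup_def)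
  have "(?c + ?l) mod k = (?c + 0) mod k"
    using col[of ?l] col[of 0] by simp
  then have "k dvd ?l"
    by (subst (asm) mod_eq_dvd_iff_nat) auto
  then obtain m where m: "?l = k * m"
    by blast
  have zero: "vs ! i = 0" if "i < ?l" "(?c + i) mod k = 0" for i
    using col[of i] that by (simp add: blowup_col_def split: if_splits)
  have "m = 1"
  proof (rule ccontr)
    assume "m \<noteq> 1"
    moreover have "m \<noteq> 0"
      using m \<open>vs \<noteq> []\<close> by (metis length_0_conv mult_0_right)
    ultimately have "k * 2 \<le> ?l"
      unfolding m by (intro mult_le_mono2) simp
    \<comment> \<open>This is the first index of colour 0 on the cycle; the next one is
      \<open>i + k\<close>.\<close>
    define i where "i = (k - ?c) mod k"
    have i: "i < k"
      using assms by (simp add: i_def)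
    have "(?c + i) mod k = (?c + (k - ?c)) mod k"
      by (simp add: i_def mod_add_right_eq)
    then have *: "(?c + i) mod k = 0"
      using c by simp
    moreover have "(?c + (i + k)) mod k = (?c + i) mod k"
      by (simp flip: add.assoc)
    ultimately have "vs ! i = 0" "vs ! (i + k) = 0"
      using zero[of i] zero[of "i + k"] i \<open>k * 2 \<le> ?l\<close> by auto
    then have "i = i + k"
      using vs i \<open>k * 2 \<le> ?l\<close> nth_eq_iff_index_eq[of vs i "i + k"] by (auto simp: vcycle_def)
    then show False
      using assms by simp
  qed
  then show "length vs \<in> {k}"
    by (simp add: m)
qed

text \<open>All arcs between consecutive classes are present, so every choice of one vertex per
  class is a transversal, and their number is the product of the class sizes.\<close>

lemma card_transversals_blowup:
  assumes "2 \<le> k" "0 < n"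
  shows "card (transversals {..<n} (parcs (blowup k n)) (blowup_col k) k)
    = (\<Prod>i<k - 1. (n - 1 + i) div (k - 1))"
proof -
  let ?m = "k - 1" and ?A = "\<lambda>i. {v \<in> {..<n}. blowup_col k v = i}"
  have "transversals {..<n} (parcs (blowup k n)) (blowup_col k) k = (\<Pi>\<^sub>E i\<in>{..<k}. ?A i)"
  proof -
    have "(g i, g (Suc i mod k)) \<in> parcs (blowup k n)"
      if "g \<in> (\<Pi>\<^sub>E i\<in>{..<k}. ?A i)" "i < k" for g i
      using PiE_mem[OF that(1), of i] PiE_mem[OF that(1), of "Suc i mod k"] that(2)
      by (auto simp: blowup_def)
    then show ?thesis
      by (auto simp: transversals_def)
  qed
  then have "card (transversals {..<n} (parcs (blowup k n)) (blowup_col k) k) = (\<Prod>i<k. card (?A i))"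
    by (simp add: card_PiE)
  also have "{..<k} = {..<Suc ?m}"
    using assms by simp
  also have "(\<Prod>i<Suc ?m. card (?A i)) = card (?A 0) * (\<Prod>i<?m. card (?A (Suc i)))"
    by (rule prod.lessThan_Suc_shift)
  also have "?A 0 = {0}"
    using assms by (auto simp: blowup_col_def)
  also have "(\<Prod>i<?m. card (?A (Suc i))) = (\<Prod>i<?m. (n - 1 + (?m - Suc i)) div ?m)"
  proof (rule prod.cong)
    fix i
    assume "i \<in> {..<?m}"
    moreover have "?A (Suc i) = Suc ` {u. u < n - 1 \<and> u mod ?m = i}"
    proof
      show "?A (Suc i) \<subseteq> Suc ` {u. u < n - 1 \<and> u mod ?m = i}"
      proof
        fix v
        assume "v \<in> ?A (Suc i)"
        then show "v \<in> Suc ` {u. u < n - 1 \<and> u mod ?m = i}"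
          by (cases v) (auto simp: blowup_col_def)
      qed
    qed (auto simp: blowup_col_def)
    ultimately show "card (?A (Suc i)) = (n - 1 + (?m - Suc i)) div ?m"
      using card_mod_eq[of i ?m "n - 1"] by (simp add: card_image)
  qed simp
  \<comment> \<open>The class sizes decrease with the colour, so the factors are listed in reverse
    order.\<close>
  also have "\<dots> = (\<Prod>i<?m. (n - 1 + i) div ?m)"
    by (rule prod.nat_diff_reindex)
  finally show ?thesis
    by simp
qed

text \<open>The vertex \<open>g i\<close> is recovered from the set of arcs as its only tail of
  colour \<open>i\<close>.\<close>

lemma inj_on_closed_arcs: "inj_on (closed_arcs k) (transversals V E col k)"
proof (rule inj_onI)
  fix g h
  assume g: "g \<in> transversals V E col k" and h: "h \<in> transversals V E col k"
    and eq: "closed_arcs k g = closed_arcs k h"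
  show "g = h"
  proof (rule PiE_ext[of g "{..<k}" "\<lambda>i. {v \<in> V. col v = i}" h])
    fix i
    assume i: "i \<in> {..<k}"
    then have "(g i, g (Suc i mod k)) \<in> closed_arcs k h"
      unfolding eq[symmetric] by (auto simp: closed_arcs_def)
    then obtain j where "j < k" "g i = h j"
      by (auto simp: closed_arcs_def)
    moreover have "col (g i) = i" "col (h j) = j"
      using g h i \<open>j < k\<close> by (auto simp: transversals_def)
    ultimately show "g i = h i"
      by simp
  qed (use g h in \<open>auto simp: transversals_def\<close>)
qed

lemma prod_le_card_directed_cycles_blowup:
  assumes "2 \<le> k" "0 < n"
  shows "(\<Prod>i<k - 1. (n - 1 + i) div (k - 1)) \<le> card (directed_cycles (blowup k n))"
proof -
  let ?T = "transversals {..<n} (parcs (blowup k n)) (blowup_col k) k"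
  have pd: "pair_digraph (blowup k n)"
    using cycle_digraph_blowup[OF assms(1)] by (simp add: cycle_digraph_def)
  have "closed_arcs k ` ?T \<subseteq> directed_cycles (blowup k n)"
  proof (rule image_subsetI)
    fix g
    assume g: "g \<in> ?T"
    let ?vs = "map g [0..<k]"
    have "closed_arcs k g = closed_arcs (length ?vs) ((!) ?vs)"
      unfolding closed_arcs_def using assms(1) by (intro image_cong) auto
    moreover have "vcycle (parcs (blowup k n)) ?vs"
      using vcycle_transversal[OF g] assms(1) by simp
    ultimately show "closed_arcs k g \<in> directed_cycles (blowup k n)"
      unfolding directed_cycles_conv_vcycle[OF pd] by blast
  qed
  then have "card ?T \<le> card (directed_cycles (blowup k n))"
    by (rule card_inj_on_le[OF inj_on_closed_arcs _ finite_directed_cycles[OF pd]])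
  then show ?thesis
    by (simp only: card_transversals_blowup[OF assms])
qed

theorem theorem5:
  fixes k n :: nat
  assumes "2 \<le> k" and "k \<le> n"
  shows "max_cycles {k} n = (\<Prod>i = 0..k - 2. (n - 1 + i) div (k - 1))"
proof -
  let ?S = "{card (directed_cycles G) | G :: nat pair_pre_digraph.
     cycle_digraph {k} G \<and> card (pverts G) = n}"
  have "{0..k - 2} = {..<k - 1}"
    using assms by auto
  moreover have "max_cycles {k} n = (\<Prod>i<k - 1. (n - 1 + i) div (k - 1))"
    unfolding max_cycles_def
  proof (rule antisym)
    show "Max ?S \<le> (\<Prod>i<k - 1. (n - 1 + i) div (k - 1))"
    proof (rule Max.boundedI[OF finite_card_directed_cycles ex_card_directed_cycles])
      fix c
      assume "c \<in> ?S"
      then obtain G :: "nat pair_pre_digraph"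
        where "c = card (directed_cycles G)" "cycle_digraph {k} G" "card (pverts G) = n"
        by blast
      then show "c \<le> (\<Prod>i<k - 1. (n - 1 + i) div (k - 1))"
        using card_directed_cycles_le_prod assms by blast
    qed
    have "card (pverts (blowup k n)) = n"
      by (simp add: blowup_def)
    then have "card (directed_cycles (blowup k n)) \<le> Max ?S"
      using cycle_digraph_blowup assms finite_card_directed_cycles by (intro Max_ge) auto
    then show "(\<Prod>i<k - 1. (n - 1 + i) div (k - 1)) \<le> Max ?S"
      using prod_le_card_directed_cycles_blowup[of k n] assms by simp
  qed
  ultimately show ?thesis
    by simp
qed

end
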